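(* Consider the thermostatted Kac master equation on $\mathbb{R}^N$ described in the context. There exists a steady state $F_N$ of this equation (a probability distribution on $\mathbb{R}^N$ with $\mathcal{L}[F_N]=0$); it is unique, and its moments of order up to $2$ coincide with those of $g^{\otimes N}$.
   Context: Fix an integer $N\ge 2$, rates $\lambda>0$, $\mu>0$, and a probability density $g$ on $\mathbb{R}$ with $g\in L^2$, $\int w\,g(w)\,dw=0$ and finite second moment $K_g=\int w^2 g(w)\,dw$. For $v\in\mathbb{R}^N$, $\theta\in[0,2\pi]$, $w\in\mathbb{R}$: $v_{ij}(\theta)$ ($i<j$) is obtained from $v$ by replacing $v_i$ with $v_i\cos\theta+v_j\sin\theta$ and $v_j$ with $-v_i\sin\theta+v_j\cos\theta$; $v_j(w,\theta)$ is obtained from $v$ by replacing $v_j$ with $v_j\cos\theta+w\sin\theta$; and $w_j^*=w\cos\theta-v_j\sin\theta$. Define $Q[F](v)=\binom{N}{2}^{-1}\sum_{i<j}\frac{1}{2\pi}\int_0^{2\pi}F(v_{ij}(\theta))\,d\theta$ and $R_j[F](v)=\int_{\mathbb{R}}\frac{1}{2\pi}\int_0^{2\pi} g(w_j^* )F(v_j(w,\theta))\,d\theta\,dw$. The master equation is $\partial_t F_N=\mathcal{L}[F_N]:=-\lambda N(I-Q)[F_N]-\mu\sum_{j=1}^N(I-R_j)[F_N]$. *)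

theory Defs
  imports "HOL-Analysis.Analysis"
begin

text \<open>Velocities v in R^N are vectors of type real^'n, with CARD('n) = N.
  The index type carries a linear order so that pairs i<j make sense.\<close>

definition pair_rot :: "'n::{finite,linorder} \<Rightarrow> 'n::{finite,linorder} \<Rightarrow> real \<Rightarrow> real^'n::{finite,linorder} \<Rightarrow> real^'n::{finite,linorder}" where
  "pair_rot i j \<theta> v = (\<chi> k. if k = i then v$i * cos \<theta> + v$j * sin \<theta>
                            else if k = j then - v$i * sin \<theta> + v$j * cos \<theta>
                            else v$k)"

text \<open>v_j(w,theta): collision of particle j with a thermostat particle of velocity w.\<close>
definition therm_rot :: "'n::{finite,linorder} \<Rightarrow> real \<Rightarrow> real \<Rightarrow> real^'n::{finite,linorder} \<Rightarrow> real^'n::{finite,linorder}" where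
  "therm_rot j w \<theta> v = (\<chi> k. if k = j then v$j * cos \<theta> + w * sin \<theta> else v$k)"

definition kacQ :: "((real^'n::{finite,linorder}) \<Rightarrow> real) \<Rightarrow> real^'n::{finite,linorder} \<Rightarrow> real" where
  "kacQ F v = (1 / real (CARD('n) choose 2)) *
     (\<Sum>p\<in>{p::'n\<times>'n. fst p < snd p}.
        (1 / (2*pi)) * (LBINT \<theta>=0..2*pi. F (pair_rot (fst p) (snd p) \<theta> v)))"

definition thermR :: "(real \<Rightarrow> real) \<Rightarrow> 'n::{finite,linorder} \<Rightarrow> ((real^'n::{finite,linorder}) \<Rightarrow> real) \<Rightarrow> real^'n::{finite,linorder} \<Rightarrow> real" where
  "thermR g j F v = (\<integral>w. (1 / (2*pi)) *
      (LBINT \<theta>=0..2*pi. g (w * cos \<theta> - v$j * sin \<theta>) * F (therm_rot j w \<theta> v)) \<partial>lborel)"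

definition kacL :: "real \<Rightarrow> real \<Rightarrow> (real \<Rightarrow> real) \<Rightarrow> ((real^'n::{finite,linorder}) \<Rightarrow> real) \<Rightarrow> real^'n::{finite,linorder} \<Rightarrow> real" where
  "kacL lam mu g F v = - lam * real CARD('n) * (F v - kacQ F v)
                    - mu * (\<Sum>j\<in>UNIV. F v - thermR g j F v)"

definition prob_density :: "((real^'n::finite) \<Rightarrow> real) \<Rightarrow> bool" where
  "prob_density F \<longleftrightarrow> F \<in> borel_measurable lborel \<and> (\<forall>v. 0 \<le> F v) \<and>
     integrable lborel F \<and> (\<integral>v. F v \<partial>lborel) = 1"

definition steady_state :: "real \<Rightarrow> real \<Rightarrow> (real \<Rightarrow> real) \<Rightarrow> ((real^'n::{finite,linorder}) \<Rightarrow> real) \<Rightarrow> bool" where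
  "steady_state lam mu g F \<longleftrightarrow> prob_density F \<and> (AE v in lborel. kacL lam mu g F v = 0)"

definition tensor_pow :: "(real \<Rightarrow> real) \<Rightarrow> (real^'n::finite) \<Rightarrow> real" where
  "tensor_pow g v = (\<Prod>i\<in>UNIV. g (v$i))"

definition same_moments_le2 :: "((real^'n::finite) \<Rightarrow> real) \<Rightarrow> ((real^'n::finite) \<Rightarrow> real) \<Rightarrow> bool" where
  "same_moments_le2 F G \<longleftrightarrow>
     integrable lborel F \<and> integrable lborel G \<and> (\<integral>v. F v \<partial>lborel) = (\<integral>v. G v \<partial>lborel) \<and>
     (\<forall>i. integrable lborel (\<lambda>v. v$i * F v) \<and> integrable lborel (\<lambda>v. v$i * G v) \<and>
          (\<integral>v. v$i * F v \<partial>lborel) = (\<integral>v. v$i * G v \<partial>lborel)) \<and>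
     (\<forall>i j. integrable lborel (\<lambda>v. v$i * v$j * F v) \<and> integrable lborel (\<lambda>v. v$i * v$j * G v) \<and>
          (\<integral>v. v$i * v$j * F v \<partial>lborel) = (\<integral>v. v$i * v$j * G v \<partial>lborel))"

end

theory Submission
  imports Defs
begin

text \<open>Up to the factor \<open>(\<lambda> + \<mu>) N\<close>, \<open>\<L>\<close> is \<open>P - I\<close>, where \<open>P\<close> is the adjoint of a Markov operator (one random collision),
  so steady states are fixed densities of \<open>P\<close>. Each thermostat collision is a uniform rotation of
  \<open>(v\<^sub>j, w)\<close> with \<open>w\<close> distributed according to \<open>g\<close>; the angle alone spreads the new velocity with a density
  at least \<open>1 / (\<pi> r)\<close> on \<open>[-r, r]\<close>, \<open>r\<^sup>2 = v\<^sub>j\<^sup>2 + w\<^sup>2\<close>. After \<open>N\<close> collisions this gives a Doeblin minorization on every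
  bounded set of velocities, and the energy \<open>|v|\<^sup>2\<close> contracts by the factor \<open>1 - \<mu> / (2N(\<lambda> + \<mu>))\<close>
  per collision up to a constant. Harris' theorem then yields the invariant density, with finite energy.
  The moment equations are linear, with strictly contracting coefficients, so their solution is unique.\<close>

section \<open>Dual pairs of operators\<close>

text \<open>One collision moves a velocity vector along a single circle or line, a null set for N
  \<ge> 2, so no minorization by a volume holds after one step. Harris' theorem is therefore applied
  to \<open>P ^^ n\<close> with n = N, and invariance under \<open>P\<close> itself has to be
  recovered afterwards. The minorizing set must be the same for all energy levels, with only the
  constant depending on the level: this forces any two invariant densities to overlap.

  All operators act on \<open>ennreal\<close>-valued functions, where sums, iterates and exchanges
  of integrals need no integrability. In return, subtraction is truncated, a gain may be infinite on
  a null set, and stationarity can be tested only on nonnegative functions. Hence the properties of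
  \<open>P\<close> are derived almost everywhere from its duality with \<open>Ps\<close>, and
  moments without a sign are reached by polarizing squares
  \<open>(c + \<alpha> \<bullet> v)\<^sup>2\<close>, a class on which \<open>Ps\<close> is
  explicit.\<close>

lemma AE_le_if_nn_integral_le:
  fixes a b :: "'a \<Rightarrow> ennreal"
  assumes [measurable]: "a \<in> borel_measurable M" "b \<in> borel_measurable M"
    and fin: "(\<integral>\<^sup>+x. b x \<partial>M) < \<infinity>"
    and le: "\<And>h. h \<in> borel_measurable M \<Longrightarrow> (\<integral>\<^sup>+x. h x * a x \<partial>M) \<le> (\<integral>\<^sup>+x. h x * b x \<partial>M)"
  shows "AE x in M. a x \<le> b x"
proof -
  \<comment> \<open>The indicator of the set where the inequality fails is the test function: it
    makes the integral of the excess vanish.\<close>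
  define A where "A = {x\<in>space M. b x < a x}"
  have [measurable]: "A \<in> sets M" unfolding A_def by measurable
  have fb: "(\<integral>\<^sup>+x. indicator A x * b x \<partial>M) < \<infinity>"
    by (rule le_less_trans[OF nn_integral_mono fin]) (auto simp: indicator_def)
  have "(\<integral>\<^sup>+x. indicator A x * a x - indicator A x * b x \<partial>M)
      = (\<integral>\<^sup>+x. indicator A x * a x \<partial>M) - (\<integral>\<^sup>+x. indicator A x * b x \<partial>M)"
    using fb by (intro nn_integral_diff) (auto simp: A_def indicator_def)
  also have "\<dots> = 0"
    using le[of "indicator A"] fb by (subst diff_eq_0_iff_ennreal) auto
  finally have "AE x in M. indicator A x * a x - indicator A x * b x = 0"
    by (subst (asm) nn_integral_0_iff_AE) auto
  moreover have "AE x in M. b x \<noteq> \<infinity>"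
    using fin by (intro nn_integral_PInf_AE) auto
  ultimately show ?thesis using AE_space
  proof eventually_elim
    case (elim x)
    then show ?case
      by (cases "x \<in> A") (auto simp: A_def diff_eq_0_iff_ennreal less_top)
  qed
qed

lemma AE_eq_if_nn_integral_eq:
  fixes a b :: "'a \<Rightarrow> ennreal"
  assumes "a \<in> borel_measurable M" "b \<in> borel_measurable M"
    and "(\<integral>\<^sup>+x. b x \<partial>M) < \<infinity>"
    and eq: "\<And>h. h \<in> borel_measurable M \<Longrightarrow> (\<integral>\<^sup>+x. h x * a x \<partial>M) = (\<integral>\<^sup>+x. h x * b x \<partial>M)"
  shows "AE x in M. a x = b x"
proof -
  have "(\<integral>\<^sup>+x. a x \<partial>M) < \<infinity>" using eq[of "\<lambda>_. 1"] assms(3) by simp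
  then have "AE x in M. b x \<le> a x"
    by (intro AE_le_if_nn_integral_le) (use assms in auto)
  moreover have "AE x in M. a x \<le> b x"
    by (intro AE_le_if_nn_integral_le) (use assms in auto)
  ultimately show ?thesis by eventually_elim auto
qed

text \<open>\<open>P\<close> transports densities, \<open>Ps\<close> gives the expected value of an
  observable after the step. Monotonicity, additivity and countable additivity of \<open>P\<close>
  are not assumed: duality yields them almost everywhere for functions of finite integral.\<close>

locale dual_operator =
  fixes M :: "'a measure" and P Ps :: "('a \<Rightarrow> ennreal) \<Rightarrow> 'a \<Rightarrow> ennreal"
  assumes P_measurable [measurable]: "f \<in> borel_measurable M \<Longrightarrow> P f \<in> borel_measurable M"
    and Ps_measurable [measurable]: "h \<in> borel_measurable M \<Longrightarrow> Ps h \<in> borel_measurable M"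
    and duality: "\<lbrakk>f \<in> borel_measurable M; h \<in> borel_measurable M\<rbrakk> \<Longrightarrow>
          (\<integral>\<^sup>+x. h x * P f x \<partial>M) = (\<integral>\<^sup>+x. Ps h x * f x \<partial>M)"
    and Ps_one: "Ps (\<lambda>_. 1) = (\<lambda>_. 1)"
begin

lemma mass_P: "f \<in> borel_measurable M \<Longrightarrow> (\<integral>\<^sup>+x. P f x \<partial>M) = (\<integral>\<^sup>+x. f x \<partial>M)"
  using duality[of f "\<lambda>_. 1"] by (simp add: Ps_one)

lemma P_mono_AE:
  assumes [measurable]: "f \<in> borel_measurable M" "f' \<in> borel_measurable M"
    and fin: "(\<integral>\<^sup>+x. f' x \<partial>M) < \<infinity>" and le: "AE x in M. f x \<le> f' x"
  shows "AE x in M. P f x \<le> P f' x"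
proof (rule AE_le_if_nn_integral_le)
  fix h :: "'a \<Rightarrow> ennreal" assume [measurable]: "h \<in> borel_measurable M"
  show "(\<integral>\<^sup>+x. h x * P f x \<partial>M) \<le> (\<integral>\<^sup>+x. h x * P f' x \<partial>M)"
    unfolding duality[OF assms(1) \<open>h \<in> borel_measurable M\<close>] duality[OF assms(2) \<open>h \<in> borel_measurable M\<close>]
    by (intro nn_integral_mono_AE, use le in eventually_elim) (auto intro: mult_left_mono)
qed (use fin in \<open>auto simp: mass_P\<close>)

lemma P_cong_AE:
  assumes "f \<in> borel_measurable M" "f' \<in> borel_measurable M"
    and fin: "(\<integral>\<^sup>+x. f' x \<partial>M) < \<infinity>" and eq: "AE x in M. f x = f' x"
  shows "AE x in M. P f x = P f' x"
proof -
  have "(\<integral>\<^sup>+x. f x \<partial>M) < \<infinity>" using fin nn_integral_cong_AE[OF eq] by simp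
  then have "AE x in M. P f' x \<le> P f x"
    by (intro P_mono_AE) (use assms in auto)
  moreover have "AE x in M. P f x \<le> P f' x"
    by (intro P_mono_AE) (use assms in auto)
  ultimately show ?thesis by eventually_elim auto
qed

lemma P_suminf_AE:
  fixes f :: "nat \<Rightarrow> 'a \<Rightarrow> ennreal"
  assumes [measurable]: "\<And>n. f n \<in> borel_measurable M"
    and fin: "(\<integral>\<^sup>+x. (\<Sum>n. f n x) \<partial>M) < \<infinity>"
  shows "AE x in M. P (\<lambda>x. \<Sum>n. f n x) x = (\<Sum>n. P (f n) x)"
proof (rule AE_eq_if_nn_integral_eq)
  show "(\<integral>\<^sup>+x. (\<Sum>n. P (f n) x) \<partial>M) < \<infinity>"
    using fin by (simp add: nn_integral_suminf mass_P)
  fix h :: "'a \<Rightarrow> ennreal" assume [measurable]: "h \<in> borel_measurable M"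
  show "(\<integral>\<^sup>+x. h x * P (\<lambda>x. \<Sum>n. f n x) x \<partial>M) = (\<integral>\<^sup>+x. h x * (\<Sum>n. P (f n) x) \<partial>M)"
    by (subst duality) (simp_all flip: ennreal_suminf_cmult add: nn_integral_suminf duality)
qed measurable

lemma P_add_AE:
  assumes [measurable]: "f \<in> borel_measurable M" "f' \<in> borel_measurable M"
    and fin: "(\<integral>\<^sup>+x. f x \<partial>M) < \<infinity>" "(\<integral>\<^sup>+x. f' x \<partial>M) < \<infinity>"
  shows "AE x in M. P (\<lambda>x. f x + f' x) x = P f x + P f' x"
proof (rule AE_eq_if_nn_integral_eq)
  show "(\<integral>\<^sup>+x. P f x + P f' x \<partial>M) < \<infinity>"
    using fin by (simp add: nn_integral_add mass_P)
  fix h :: "'a \<Rightarrow> ennreal" assume [measurable]: "h \<in> borel_measurable M"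
  show "(\<integral>\<^sup>+x. h x * P (\<lambda>x. f x + f' x) x \<partial>M) = (\<integral>\<^sup>+x. h x * (P f x + P f' x) \<partial>M)"
    by (subst duality) (simp_all add: distrib_left nn_integral_add duality)
qed measurable

lemma P_scale_AE:
  assumes [measurable]: "f \<in> borel_measurable M"
    and fin: "(\<integral>\<^sup>+x. f x \<partial>M) < \<infinity>" and c: "c < \<infinity>"
  shows "AE x in M. P (\<lambda>x. c * f x) x = c * P f x"
proof (rule AE_eq_if_nn_integral_eq)
  show "(\<integral>\<^sup>+x. c * P f x \<partial>M) < \<infinity>"
    using fin c by (simp add: nn_integral_cmult mass_P ennreal_mult_less_top)
  fix h :: "'a \<Rightarrow> ennreal" assume [measurable]: "h \<in> borel_measurable M"
  show "(\<integral>\<^sup>+x. h x * P (\<lambda>x. c * f x) x \<partial>M) = (\<integral>\<^sup>+x. h x * (c * P f x) \<partial>M)"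
    by (subst duality) (simp_all add: mult.left_commute[of _ c] nn_integral_cmult duality)
qed measurable

lemma dual_operator_funpow: "dual_operator M (P ^^ n) (Ps ^^ n)"
proof (induction n)
  case 0
  show ?case by standard auto
next
  case (Suc n)
  interpret I: dual_operator M "P ^^ n" "Ps ^^ n" by fact
  show ?case
  proof
    fix f h :: "'a \<Rightarrow> ennreal"
    show "f \<in> borel_measurable M \<Longrightarrow> (P ^^ Suc n) f \<in> borel_measurable M" by simp
    show "h \<in> borel_measurable M \<Longrightarrow> (Ps ^^ Suc n) h \<in> borel_measurable M" by simp
    show "(\<integral>\<^sup>+x. h x * (P ^^ Suc n) f x \<partial>M) = (\<integral>\<^sup>+x. (Ps ^^ Suc n) h x * f x \<partial>M)"
      if "f \<in> borel_measurable M" "h \<in> borel_measurable M"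
      using that by (simp only: funpow.simps(2) o_apply duality I.P_measurable I.duality Ps_measurable flip: funpow_swap1)
  qed (simp add: Ps_one I.Ps_one)
qed

lemma invariant_funpow_AE:
  assumes [measurable]: "f \<in> borel_measurable M" and fin: "(\<integral>\<^sup>+x. f x \<partial>M) < \<infinity>"
    and inv: "AE x in M. P f x = f x"
  shows "AE x in M. (P ^^ n) f x = f x"
proof (induction n)
  case (Suc n)
  interpret I: dual_operator M "P ^^ n" "Ps ^^ n" by (rule dual_operator_funpow)
  have "AE x in M. P ((P ^^ n) f) x = P f x"
    by (rule P_cong_AE) (use fin Suc in auto)
  then show ?case using inv by eventually_elim simp
qed simp

text \<open>Monotonicity makes the minimum \<open>m\<close> of two invariant functions subinvariant,
  \<open>P m \<le> m\<close>. As \<open>P\<close> preserves its finite mass, equality holds almost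
  everywhere, and additivity passes this on to the difference.\<close>

lemma invariant_diff_min:
  assumes [measurable]: "f \<in> borel_measurable M" "f' \<in> borel_measurable M"
    and fin: "(\<integral>\<^sup>+x. f x \<partial>M) < \<infinity>" "(\<integral>\<^sup>+x. f' x \<partial>M) < \<infinity>"
    and inv: "AE x in M. P f x = f x" "AE x in M. P f' x = f' x"
  shows "AE x in M. P (\<lambda>x. f x - min (f x) (f' x)) x = f x - min (f x) (f' x)"
proof -
  define m where "m x = min (f x) (f' x)" for x
  have [measurable]: "m \<in> borel_measurable M" unfolding m_def by measurable
  have mf: "(\<integral>\<^sup>+x. m x \<partial>M) < \<infinity>"
    by (rule le_less_trans[OF nn_integral_mono fin(1)]) (auto simp: m_def)
  have df: "(\<integral>\<^sup>+x. f x - m x \<partial>M) < \<infinity>"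
    by (rule le_less_trans[OF nn_integral_mono fin(1)]) (auto simp: m_def diff_le_self_ennreal)
  have "AE x in M. P m x \<le> P f x" by (rule P_mono_AE[OF _ _ fin(1)]) (auto simp: m_def)
  moreover have "AE x in M. P m x \<le> P f' x" by (rule P_mono_AE[OF _ _ fin(2)]) (auto simp: m_def)
  ultimately have le: "AE x in M. P m x \<le> m x"
    using inv by eventually_elim (auto simp: m_def)
  have "(\<integral>\<^sup>+x. m x - P m x \<partial>M) = (\<integral>\<^sup>+x. m x \<partial>M) - (\<integral>\<^sup>+x. P m x \<partial>M)"
    using mf by (intro nn_integral_diff le) (auto simp: mass_P)
  also have "\<dots> = 0" using mf by (simp add: mass_P diff_eq_0_iff_ennreal)
  finally have "AE x in M. m x - P m x = 0"
    by (subst (asm) nn_integral_0_iff_AE) auto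
  moreover have mt: "AE x in M. m x \<noteq> \<infinity>"
    using mf by (intro nn_integral_PInf_AE) auto
  ultimately have Pm: "AE x in M. P m x = m x"
    using le by eventually_elim (auto simp: diff_eq_0_iff_ennreal less_top)
  have "AE x in M. P (\<lambda>x. (f x - m x) + m x) x = P (\<lambda>x. f x - m x) x + P m x"
    by (rule P_add_AE) (use mf df in auto)
  moreover have "(\<lambda>x. (f x - m x) + m x) = f"
    by (auto simp: m_def fun_eq_iff diff_add_cancel_ennreal)
  ultimately have "AE x in M. P f x = P (\<lambda>x. f x - m x) x + P m x" by simp
  then have "AE x in M. P (\<lambda>x. f x - m x) x = f x - m x"
    using Pm inv(1) mt
  proof eventually_elim
    case (elim x)
    then have "f x = P (\<lambda>x. f x - m x) x + m x" by simp
    then have "f x - m x = P (\<lambda>x. f x - m x) x"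
      using elim(4) by (metis ennreal_add_diff_cancel_right infinity_ennreal_def)
    then show ?case ..
  qed
  then show ?thesis by (simp add: m_def)
qed

end

section \<open>Harris' theorem\<close>

context dual_operator begin

text \<open>Dual reading of the Doeblin condition: a lower bound for \<open>Ps h\<close> on a level
  set of \<open>V\<close> becomes a lower bound for \<open>P f\<close>, weighted by the mass that
  \<open>f\<close> puts on that level set. Testing against \<open>h\<close> exchanges the two
  forms.\<close>

lemma minorization_AE:
  fixes V :: "'a \<Rightarrow> real"
  assumes [measurable]: "V \<in> borel_measurable M" "U \<in> sets M" "f \<in> borel_measurable M"
    and fin: "(\<integral>\<^sup>+x. f x \<partial>M) < \<infinity>"
    and minor: "\<And>h x. \<lbrakk>h \<in> borel_measurable M; x \<in> space M; V x \<le> r\<rbrakk> \<Longrightarrow>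
        \<epsilon> * (\<integral>\<^sup>+y. h y * indicator U y \<partial>M) \<le> Ps h x"
  shows "AE x in M. \<epsilon> * (\<integral>\<^sup>+y. f y * indicator {y. V y \<le> r} y \<partial>M) * indicator U x \<le> P f x"
proof (rule AE_le_if_nn_integral_le)
  let ?s = "\<integral>\<^sup>+y. f y * indicator {y. V y \<le> r} y \<partial>M"
  fix h :: "'a \<Rightarrow> ennreal" assume [measurable]: "h \<in> borel_measurable M"
  have "(\<integral>\<^sup>+x. h x * (\<epsilon> * ?s * indicator U x) \<partial>M) = (\<epsilon> * ?s) * (\<integral>\<^sup>+x. h x * indicator U x \<partial>M)"
    by (subst nn_integral_cmult[symmetric]) (auto simp: ac_simps)
  also have "\<dots> = \<epsilon> * (\<integral>\<^sup>+x. h x * indicator U x \<partial>M) * ?s" by (simp add: ac_simps)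
  also have "\<dots> = (\<integral>\<^sup>+y. \<epsilon> * (\<integral>\<^sup>+x. h x * indicator U x \<partial>M) * (f y * indicator {y. V y \<le> r} y) \<partial>M)"
    by (subst nn_integral_cmult) auto
  also have "\<dots> \<le> (\<integral>\<^sup>+y. Ps h y * f y \<partial>M)"
    using minor[of h] by (intro nn_integral_mono) (auto simp: indicator_def intro!: mult_right_mono)
  also have "\<dots> = (\<integral>\<^sup>+x. h x * P f x \<partial>M)" by (subst duality) auto
  finally show "(\<integral>\<^sup>+x. h x * (\<epsilon> * ?s * indicator U x) \<partial>M) \<le> (\<integral>\<^sup>+x. h x * P f x \<partial>M)" .
qed (use fin in \<open>auto simp: mass_P\<close>)

text \<open>The minorization sees only the mass below a level of \<open>V\<close>. The integer
  levels exhaust the space, so a function that vanishes almost everywhere below each of them is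
  null.\<close>

lemma exhaustion_mass_pos:
  fixes V :: "'a \<Rightarrow> real"
  assumes [measurable]: "V \<in> borel_measurable M" "f \<in> borel_measurable M"
    and pos: "(\<integral>\<^sup>+x. f x \<partial>M) > 0"
  shows "\<exists>n::nat. (\<integral>\<^sup>+y. f y * indicator {y. V y \<le> real n} y \<partial>M) > 0"
proof (rule ccontr)
  assume "\<not> ?thesis"
  then have "AE y in M. f y * indicator {y. V y \<le> real n} y = 0" for n
    by (subst nn_integral_0_iff_AE[symmetric]) auto
  then have "AE y in M. \<forall>n. f y * indicator {y. V y \<le> real n} y = 0"
    by (subst AE_all_countable) auto
  then have "AE y in M. f y = 0"
  proof eventually_elim
    case (elim y)
    obtain n where "V y \<le> real n" using real_arch_simple by blast
    with elim[rule_format, of n] show ?case by simp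
  qed
  then have "(\<integral>\<^sup>+x. f x \<partial>M) = 0" by (subst nn_integral_0_iff_AE) auto
  with pos show False by simp
qed

text \<open>If two invariant densities differ, both \<open>f - min f f'\<close> and \<open>f' - min f f'\<close> are invariant
  and nonzero, so the minorization makes both positive on \<open>U\<close>; but their minimum vanishes.\<close>

lemma invariant_unique:
  fixes V :: "'a \<Rightarrow> real"
  assumes [measurable]: "V \<in> borel_measurable M" "U \<in> sets M"
    and U: "emeasure M U > 0"
    and minor: "\<And>r. \<exists>\<epsilon>>0. \<forall>h x. h \<in> borel_measurable M \<longrightarrow> x \<in> space M \<longrightarrow> V x \<le> r \<longrightarrow>
        ennreal \<epsilon> * (\<integral>\<^sup>+y. h y * indicator U y \<partial>M) \<le> Ps h x"
    and [measurable]: "f \<in> borel_measurable M" "f' \<in> borel_measurable M"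
    and mass: "(\<integral>\<^sup>+x. f x \<partial>M) = 1" "(\<integral>\<^sup>+x. f' x \<partial>M) = 1"
    and inv: "AE x in M. P f x = f x" "AE x in M. P f' x = f' x"
  shows "AE x in M. f x = f' x"
proof -
  define m where "m x = min (f x) (f' x)" for x
  have [measurable]: "m \<in> borel_measurable M" unfolding m_def by measurable
  have m_le: "m x \<le> f x" "m x \<le> f' x" for x by (auto simp: m_def)
  have mf: "(\<integral>\<^sup>+x. m x \<partial>M) < \<infinity>"
    using nn_integral_mono[of M m f] m_le mass by (auto intro: le_less_trans)
  have invd: "AE x in M. P (\<lambda>x. f x - m x) x = f x - m x" "AE x in M. P (\<lambda>x. f' x - m x) x = f' x - m x"
    using invariant_diff_min[of f f'] invariant_diff_min[of f' f] inv mass by (simp_all add: m_def min.commute)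
  \<comment> \<open>Equal total masses give both remainders the same mass, so they are null together
    or not at all.\<close>
  have mass_d: "(\<integral>\<^sup>+x. f x - m x \<partial>M) = 1 - (\<integral>\<^sup>+x. m x \<partial>M)" "(\<integral>\<^sup>+x. f' x - m x \<partial>M) = 1 - (\<integral>\<^sup>+x. m x \<partial>M)"
    using mf by (subst nn_integral_diff; simp add: m_le mass)+
  have mt: "AE x in M. m x \<noteq> \<infinity>" using mf by (intro nn_integral_PInf_AE) auto
  have key: "AE x in M. x \<in> U \<longrightarrow> 0 < d x"
    if [measurable]: "d \<in> borel_measurable M" and fin: "(\<integral>\<^sup>+x. d x \<partial>M) < \<infinity>" and pos: "0 < (\<integral>\<^sup>+x. d x \<partial>M)"
      and inv: "AE x in M. P d x = d x" for d
  proof -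
    obtain n :: nat where n: "(\<integral>\<^sup>+y. d y * indicator {y. V y \<le> real n} y \<partial>M) > 0"
      using exhaustion_mass_pos[of V d] pos by auto
    obtain \<epsilon> where \<epsilon>: "\<epsilon> > 0" "\<And>h x. \<lbrakk>h \<in> borel_measurable M; x \<in> space M; V x \<le> real n\<rbrakk> \<Longrightarrow>
        ennreal \<epsilon> * (\<integral>\<^sup>+y. h y * indicator U y \<partial>M) \<le> Ps h x" using minor[of "real n"] by auto
    have "AE x in M. ennreal \<epsilon> * (\<integral>\<^sup>+y. d y * indicator {y. V y \<le> real n} y \<partial>M) * indicator U x \<le> P d x"
      by (rule minorization_AE[OF _ _ _ fin \<epsilon>(2)]) auto
    with inv show ?thesis
    proof eventually_elim
      case (elim x)
      have "0 < ennreal \<epsilon> * (\<integral>\<^sup>+y. d y * indicator {y. V y \<le> real n} y \<partial>M)"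
        using n \<epsilon>(1) by (simp add: ennreal_zero_less_mult_iff)
      with elim show ?case by (auto simp: indicator_def)
    qed
  qed
  have "(\<integral>\<^sup>+x. f x - m x \<partial>M) = 0"
  proof (rule ccontr)
    assume "(\<integral>\<^sup>+x. f x - m x \<partial>M) \<noteq> 0"
    then have p: "(\<integral>\<^sup>+x. f x - m x \<partial>M) > 0" "(\<integral>\<^sup>+x. f' x - m x \<partial>M) > 0"
      by (simp_all add: mass_d zero_less_iff_neq_zero)
    have fin: "(\<integral>\<^sup>+x. f x - m x \<partial>M) < \<infinity>" "(\<integral>\<^sup>+x. f' x - m x \<partial>M) < \<infinity>"
      by (auto simp: mass_d intro: le_less_trans[OF diff_le_self_ennreal])
    have "AE x in M. x \<in> U \<longrightarrow> 0 < f x - m x" by (rule key) (use p fin invd in auto)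
    moreover have "AE x in M. x \<in> U \<longrightarrow> 0 < f' x - m x" by (rule key) (use p fin invd in auto)
    ultimately have "AE x in M. x \<notin> U" using mt
    proof eventually_elim
      case (elim x)
      then show ?case
        by (cases "f x \<le> f' x") (auto simp: m_def diff_eq_0_iff_ennreal less_top min_def split: if_splits)
    qed
    then have "emeasure M U = 0" by (subst (asm) AE_iff_measurable[of U]) (use sets.sets_into_space[OF assms(2)] in auto)
    with U show False by simp
  qed
  moreover from this have "(\<integral>\<^sup>+x. f' x - m x \<partial>M) = 0" by (simp add: mass_d)
  ultimately have "AE x in M. f x - m x = 0" "AE x in M. f' x - m x = 0"
    by (simp_all add: nn_integral_0_iff_AE)
  then show ?thesis using mt
  proof eventually_elim
    case (elim x)
    then have "f x \<le> m x" "f' x \<le> m x"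
      by (auto simp: diff_eq_0_iff_ennreal less_top)
    with m_le[of x] show ?case by (simp add: antisym)
  qed
qed

text \<open>Subtracting the minorizing part from \<open>P\<close> leaves an operator that contracts
  the norm with weight \<open>1 + \<beta> V\<close>; summing its iterates started at \<open>U\<close> gives the invariant density.\<close>

lemma invariant_exists:
  fixes V :: "'a \<Rightarrow> real"
  assumes [measurable]: "V \<in> borel_measurable M" "U \<in> sets M"
    and V0: "\<And>x. 0 \<le> V x"
    and U: "emeasure M U > 0" "emeasure M U < \<infinity>" and UV: "(\<integral>\<^sup>+x. ennreal (V x) * indicator U x \<partial>M) < \<infinity>"
    and minor: "\<And>r. \<exists>\<epsilon>>0. \<forall>h x. h \<in> borel_measurable M \<longrightarrow> x \<in> space M \<longrightarrow> V x \<le> r \<longrightarrow>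
        ennreal \<epsilon> * (\<integral>\<^sup>+y. h y * indicator U y \<partial>M) \<le> Ps h x"
    and gam: "0 \<le> \<gamma>" "\<gamma> < 1" and C: "0 < C"
    and drift: "\<And>x. x \<in> space M \<Longrightarrow> Ps (\<lambda>x. ennreal (V x)) x \<le> ennreal (\<gamma> * V x + C)"
  shows "\<exists>f :: 'a \<Rightarrow> ennreal. f \<in> borel_measurable M \<and> (\<integral>\<^sup>+x. f x \<partial>M) = 1 \<and> (AE x in M. P f x = f x) \<and> (\<integral>\<^sup>+x. V x * f x \<partial>M) < \<infinity>"
proof -
  \<comment> \<open>The rate \<open>\<rho>\<close> below keeps at least half of the gap
    \<open>1 - \<gamma>\<close>, that is \<open>\<rho> - \<gamma> \<ge> (1 - \<gamma>) / 2\<close>.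
    Beyond the level \<open>r\<close> this half is still worth \<open>2 * C\<close>.\<close>
  define r where "r = 4 * C / (1 - \<gamma>)"
  obtain \<epsilon> where \<epsilon>: "\<epsilon> > 0" "\<And>h x. \<lbrakk>h \<in> borel_measurable M; x \<in> space M; V x \<le> r\<rbrakk> \<Longrightarrow>
        ennreal \<epsilon> * (\<integral>\<^sup>+y. h y * indicator U y \<partial>M) \<le> Ps h x" using minor[of r] by auto
  define vol where "vol = measure M U"
  have vol: "emeasure M U = ennreal vol" using U by (simp add: vol_def emeasure_eq_ennreal_measure)
  have vol0: "vol > 0" using U vol by (simp add: ennreal_less_zero_iff)
  define e where "e = \<epsilon> * vol"
  have e0: "e > 0" using \<epsilon> vol0 by (simp add: e_def)
  \<comment> \<open>The weight makes \<open>\<beta> * C\<close> half of the minorizing mass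
    \<open>e\<close>, and \<open>\<eta> = 1 - \<rho>\<close> is at most the other half. Below level
    \<open>r\<close> the drift constant and the loss \<open>\<eta>\<close> are paid by
    \<open>e\<close>; above it they are paid by
    \<open>(\<rho> - \<gamma>) * \<beta> * V \<ge> 2 * \<beta> * C = e\<close>.\<close>
  define \<beta> where "\<beta> = e / (2 * C)"
  define \<eta> where "\<eta> = min (e / 2) ((1 - \<gamma>) / 2)"
  define \<rho> where "\<rho> = 1 - \<eta>"
  have \<beta>0: "\<beta> > 0" using e0 C by (simp add: \<beta>_def)
  have \<beta>C: "\<beta> * C = e / 2" using C by (simp add: \<beta>_def)
  have \<eta>: "0 < \<eta>" "\<eta> \<le> e/2" "\<eta> \<le> (1-\<gamma>)/2" "\<eta> \<le> 1/2" using e0 gam by (auto simp: \<eta>_def min_def)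
  have \<rho>: "0 \<le> \<rho>" "\<rho> < 1" using \<eta> by (auto simp: \<rho>_def)
  define W where "W x = 1 + \<beta> * V x" for x
  have W1: "W x \<ge> 1" for x using \<beta>0 V0[of x] by (simp add: W_def)
  have [measurable]: "W \<in> borel_measurable M" unfolding W_def by measurable
  have contr: "1 + \<beta> * (\<gamma> * V x + C) \<le> \<rho> * W x + e * indicator {x. V x \<le> r} x" for x
  proof (cases "V x \<le> r")
    case True
    have "\<gamma> * (\<beta> * V x) \<le> \<rho> * (\<beta> * V x)"
      using \<beta>0 V0[of x] \<eta> by (intro mult_right_mono) (auto simp: \<rho>_def)
    moreover have "1 + \<beta> * C \<le> \<rho> + e" using \<eta> \<beta>C by (simp add: \<rho>_def)
    ultimately show ?thesis using True by (simp add: W_def algebra_simps)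
  next
    case False
    have "(1-\<gamma>)/2 * (\<beta> * r) \<le> (\<rho> - \<gamma>) * (\<beta> * V x)"
      using \<beta>0 V0[of x] \<eta> False gam C by (intro mult_mono) (auto simp: \<rho>_def r_def)
    also have "(1-\<gamma>)/2 * (\<beta> * r) = 2 * (\<beta> * C)" using gam by (simp add: r_def field_simps)
    finally show ?thesis using False \<eta> \<beta>C by (simp add: W_def \<rho>_def algebra_simps)
  qed
  define s where "s f = ennreal \<epsilon> * (\<integral>\<^sup>+y. f y * indicator {y. V y \<le> r} y \<partial>M)" for f :: "'a \<Rightarrow> ennreal"
  define u :: "'a \<Rightarrow> ennreal" where "u = indicator U"
  have [measurable]: "u \<in> borel_measurable M" by (simp add: u_def)
  \<comment> \<open>The subtraction is genuine almost everywhere for \<open>f\<close> of finite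
    integral, since the minorization gives \<open>s f * u \<le> P f\<close> there; this is the
    content of \<open>PF\<close> below.\<close>
  define T where "T f = (\<lambda>x. P f x - s f * u x)" for f
  have T_meas[measurable]: "T f \<in> borel_measurable M" if [measurable]: "f \<in> borel_measurable M" for f
    unfolding T_def by measurable
  define F where "F n = (T ^^ n) u" for n
  have F0: "F 0 = u" and FS: "F (Suc n) = T (F n)" for n by (auto simp: F_def)
  have F_meas[measurable]: "F n \<in> borel_measurable M" for n
    by (induction n) (auto simp: F0 FS)
  define B where "B = (\<integral>\<^sup>+x. W x * u x \<partial>M)"
  have B: "B < \<infinity>"
  proof -
    have "B = (\<integral>\<^sup>+x. u x + ennreal \<beta> * (ennreal (V x) * indicator U x) \<partial>M)"
      unfolding B_def W_def using V0 \<beta>0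
      by (intro nn_integral_cong) (auto simp: u_def indicator_def ennreal_mult)
    also have "\<dots> = emeasure M U + ennreal \<beta> * (\<integral>\<^sup>+x. ennreal (V x) * indicator U x \<partial>M)"
      by (subst nn_integral_add) (auto simp: nn_integral_cmult u_def)
    finally show ?thesis using U UV by (simp add: ennreal_mult_less_top)
  qed
  have volB: "ennreal vol \<le> B"
    unfolding vol[symmetric] B_def u_def
    by (subst nn_integral_indicator[symmetric], simp, intro nn_integral_mono)
       (auto simp: indicator_def W1 intro: ennreal_leI)
  have massW: "(\<integral>\<^sup>+x. f x \<partial>M) \<le> (\<integral>\<^sup>+x. W x * f x \<partial>M)" for f :: "'a \<Rightarrow> ennreal"
  proof (rule nn_integral_mono)
    fix x
    have "1 * f x \<le> ennreal (W x) * f x" by (intro mult_right_mono) (auto simp: W1)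
    then show "f x \<le> ennreal (W x) * f x" by simp
  qed
  have s_le: "s f \<le> ennreal \<epsilon> * (\<integral>\<^sup>+x. f x \<partial>M)" for f
    unfolding s_def by (intro mult_left_mono nn_integral_mono) (auto simp: indicator_def)
  have PF: "AE x in M. P f x = T f x + s f * u x" 
    if [measurable]: "f \<in> borel_measurable M" and fin: "(\<integral>\<^sup>+x. f x \<partial>M) < \<infinity>" for f
  proof -
    have "AE x in M. s f * u x \<le> P f x"
      unfolding s_def u_def by (rule minorization_AE[OF _ _ _ fin \<epsilon>(2)]) auto
    then show ?thesis by eventually_elim (simp add: T_def diff_add_cancel_ennreal)
  qed
  \<comment> \<open>Duality moves \<open>P\<close> onto the weight, where the drift applies. The
    indicator term of \<open>contr\<close> contributes exactly \<open>s f * vol\<close>, and because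
    \<open>W \<ge> 1\<close> this is at most the weighted mass \<open>s f * B\<close> that was
    removed from \<open>P f\<close>.\<close>
  have step: "(\<integral>\<^sup>+x. W x * T f x \<partial>M) \<le> ennreal \<rho> * (\<integral>\<^sup>+x. W x * f x \<partial>M)"
    if [measurable]: "f \<in> borel_measurable M" and finW: "(\<integral>\<^sup>+x. W x * f x \<partial>M) < \<infinity>" for f :: "'a \<Rightarrow> ennreal"
  proof -
    have fin: "(\<integral>\<^sup>+x. f x \<partial>M) < \<infinity>" using massW finW by (rule le_less_trans)
    have "s f < \<infinity>" by (rule le_less_trans[OF s_le]) (use fin in \<open>simp add: ennreal_mult_less_top\<close>)
    then have sB: "s f * B < \<infinity>" using B by (simp add: ennreal_mult_less_top)
    have "(\<integral>\<^sup>+x. W x * T f x \<partial>M) + s f * B = (\<integral>\<^sup>+x. W x * T f x + s f * (W x * u x) \<partial>M)"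
      by (simp add: nn_integral_add nn_integral_cmult B_def)
    also have "\<dots> = (\<integral>\<^sup>+x. W x * P f x \<partial>M)"
      by (intro nn_integral_cong_AE, use PF[OF that(1) fin] in eventually_elim) (simp add: algebra_simps)
    also have "\<dots> = (\<integral>\<^sup>+x. P f x + ennreal \<beta> * (ennreal (V x) * P f x) \<partial>M)"
      using V0 \<beta>0 by (intro nn_integral_cong) (simp add: W_def ennreal_mult ring_distribs ac_simps)
    also have "\<dots> = (\<integral>\<^sup>+x. f x \<partial>M) + ennreal \<beta> * (\<integral>\<^sup>+x. Ps (\<lambda>x. ennreal (V x)) x * f x \<partial>M)"
      by (simp add: nn_integral_add nn_integral_cmult mass_P duality)
    also have "\<dots> = (\<integral>\<^sup>+x. (1 + ennreal \<beta> * Ps (\<lambda>x. ennreal (V x)) x) * f x \<partial>M)"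
      by (simp add: ring_distribs nn_integral_add nn_integral_cmult mult.assoc)
    also have "\<dots> \<le> (\<integral>\<^sup>+x. (ennreal \<rho> * W x + ennreal e * indicator {x. V x \<le> r} x) * f x \<partial>M)"
    proof (intro nn_integral_mono mult_right_mono)
      fix x assume x: "x \<in> space M"
      have "1 + ennreal \<beta> * Ps (\<lambda>x. ennreal (V x)) x \<le> 1 + ennreal \<beta> * ennreal (\<gamma> * V x + C)"
        using drift[OF x] by (intro add_left_mono mult_left_mono) auto
      also have "\<dots> = ennreal (1 + \<beta> * (\<gamma> * V x + C))"
        using V0 \<beta>0 gam C by (simp add: ennreal_mult)
      also have "\<dots> \<le> ennreal (\<rho> * W x + e * indicator {x. V x \<le> r} x)"
        by (intro ennreal_leI contr)
      also have "\<dots> = ennreal \<rho> * W x + ennreal e * indicator {x. V x \<le> r} x"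
        using \<rho> e0 W1[of x] by (auto simp: indicator_def ennreal_mult)
      finally show "1 + ennreal \<beta> * Ps (\<lambda>x. ennreal (V x)) x \<le> \<dots>" .
    qed simp
    also have "\<dots> = (\<integral>\<^sup>+x. ennreal \<rho> * (W x * f x) + ennreal e * (f x * indicator {x. V x \<le> r} x) \<partial>M)"
      by (intro nn_integral_cong) (simp add: ring_distribs ac_simps)
    also have "\<dots> = ennreal \<rho> * (\<integral>\<^sup>+x. W x * f x \<partial>M) + s f * ennreal vol"
      using \<epsilon>(1) vol0
      by (simp add: nn_integral_add nn_integral_cmult s_def e_def ennreal_mult ac_simps)
    also have "\<dots> \<le> ennreal \<rho> * (\<integral>\<^sup>+x. W x * f x \<partial>M) + s f * B"
      using volB by (intro add_left_mono mult_left_mono) auto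
    finally show ?thesis using sB by (auto simp: add.commute[of _ "s f * B"] ennreal_add_left_cancel_le)
  qed
  have W_F: "(\<integral>\<^sup>+x. W x * F n x \<partial>M) \<le> ennreal (\<rho> ^ n) * B" for n
  proof (induction n)
    case 0
    show ?case by (simp add: F0 B_def)
  next
    case (Suc n)
    have "(\<integral>\<^sup>+x. W x * F (Suc n) x \<partial>M) \<le> ennreal \<rho> * (\<integral>\<^sup>+x. W x * F n x \<partial>M)"
      unfolding FS by (rule step) (use Suc B in \<open>auto intro: le_less_trans simp: ennreal_mult_less_top\<close>)
    also have "\<dots> \<le> ennreal \<rho> * (ennreal (\<rho> ^ n) * B)"
      by (intro mult_left_mono Suc) auto
    finally show ?case using \<rho> by (simp add: ennreal_mult mult.assoc)
  qed
  \<comment> \<open>Neumann series for \<open>(I - T) G = u\<close>. Since \<open>P\<close> is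
    \<open>T\<close> plus \<open>s\<close> times \<open>u\<close>, this is the invariance equation
    under the normalization \<open>s G = 1\<close>.\<close>
  define G where "G x = (\<Sum>n. F n x)" for x
  have [measurable]: "G \<in> borel_measurable M" unfolding G_def by measurable
  have GW: "(\<integral>\<^sup>+x. W x * G x \<partial>M) < \<infinity>"
  proof -
    have "(\<integral>\<^sup>+x. W x * G x \<partial>M) = (\<Sum>n. \<integral>\<^sup>+x. W x * F n x \<partial>M)"
      by (simp add: G_def nn_integral_suminf flip: ennreal_suminf_cmult)
    also have "\<dots> \<le> (\<Sum>n. ennreal (\<rho> ^ n) * B)" by (intro suminf_le W_F) auto
    also have "\<dots> = ennreal (\<Sum>n. \<rho> ^ n) * B"
      using \<rho> by (simp add: ennreal_suminf_multc suminf_ennreal2 summable_geometric)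
    also have "\<dots> < \<infinity>" using B by (simp add: ennreal_mult_less_top)
    finally show ?thesis .
  qed
  have Gfin: "(\<integral>\<^sup>+x. G x \<partial>M) < \<infinity>" using massW GW by (rule le_less_trans)
  have Ffin: "(\<integral>\<^sup>+x. F n x \<partial>M) < \<infinity>" for n
    by (rule le_less_trans[OF order_trans[OF massW W_F]]) (use B in \<open>simp add: ennreal_mult_less_top\<close>)
  define S where "S = (\<Sum>n. s (F n))"
  have Geq: "G x = u x + (\<Sum>n. F (Suc n) x)" for x
    unfolding G_def using suminf_offset[of "\<lambda>n. F n x" 1] by (simp add: F0)
  have "AE x in M. \<forall>n. P (F n) x = F (Suc n) x + s (F n) * u x"
    unfolding AE_all_countable FS by (intro allI PF Ffin F_meas)
  moreover have "AE x in M. P G x = (\<Sum>n. P (F n) x)"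
    unfolding G_def by (rule P_suminf_AE) (use Gfin in \<open>auto simp: G_def\<close>)
  ultimately have PG: "AE x in M. P G x + u x = G x + S * u x"
  proof eventually_elim
    case (elim x)
    have "P G x = (\<Sum>n. F (Suc n) x + s (F n) * u x)" using elim by simp
    also have "\<dots> = (\<Sum>n. F (Suc n) x) + S * u x"
      by (simp add: suminf_add[symmetric] S_def ennreal_suminf_multc)
    finally show ?case by (simp add: Geq ac_simps)
  qed
  \<comment> \<open>Conservation of mass fixes the one unknown: after the finite mass of
    \<open>G\<close> is cancelled, \<open>vol = S * vol\<close> remains, so \<open>S = 1\<close> and
    the two terms with \<open>u\<close> in \<open>PG\<close> cancel.\<close>
  have "(\<integral>\<^sup>+x. G x \<partial>M) + ennreal vol = (\<integral>\<^sup>+x. P G x + u x \<partial>M)"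
    by (simp add: nn_integral_add mass_P u_def vol)
  also have "\<dots> = (\<integral>\<^sup>+x. G x + S * u x \<partial>M)" by (rule nn_integral_cong_AE[OF PG])
  also have "\<dots> = (\<integral>\<^sup>+x. G x \<partial>M) + S * ennreal vol"
    by (simp add: nn_integral_add nn_integral_cmult u_def vol)
  finally have "ennreal vol = S * ennreal vol" using Gfin by auto
  then have S1: "S = 1"
    using vol0 ennreal_mult_cancel_left[of "ennreal vol" 1 S] by (auto simp: mult.commute)
  have inv: "AE x in M. P G x = G x"
    using PG by eventually_elim (auto simp: S1 u_def split: split_indicator_asm)
  define c where "c = (\<integral>\<^sup>+x. G x \<partial>M)"
  have "ennreal vol \<le> c"
    unfolding c_def vol[symmetric] using Geq
    by (subst nn_integral_indicator[symmetric], simp, intro nn_integral_mono) (simp add: u_def)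
  then have c0: "c > 0" using vol0 by (simp add: less_le_trans[of 0 "ennreal vol" c])
  have c: "c \<noteq> 0" "c < \<infinity>" using c0 Gfin by (auto simp: c_def)
  have ic: "inverse c < \<infinity>" using c by (simp add: less_top[symmetric])
  show ?thesis
  proof (intro exI[of _ "\<lambda>x. inverse c * G x"] conjI)
    show "(\<integral>\<^sup>+x. inverse c * G x \<partial>M) = 1"
      using c by (simp add: nn_integral_cmult c_def[symmetric] mult.commute[of _ c] ennreal_divide_self
          flip: divide_ennreal_def)
    have "AE x in M. P (\<lambda>x. inverse c * G x) x = inverse c * P G x"
      by (rule P_scale_AE) (use Gfin ic in auto)
    then show "AE x in M. P (\<lambda>x. inverse c * G x) x = inverse c * G x"
      using inv by eventually_elim simp
    have "(\<integral>\<^sup>+x. ennreal \<beta> * (V x * G x) \<partial>M) \<le> (\<integral>\<^sup>+x. W x * G x \<partial>M)"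
      using V0 \<beta>0 by (intro nn_integral_mono) (auto simp: W_def ennreal_mult[symmetric] mult.assoc[symmetric] intro!: mult_right_mono ennreal_leI simp flip: ennreal_1 ennreal_plus)
    then have "ennreal \<beta> * (\<integral>\<^sup>+x. V x * G x \<partial>M) < \<infinity>"
      using GW by (simp add: nn_integral_cmult le_less_trans)
    then have "(\<integral>\<^sup>+x. V x * G x \<partial>M) < \<infinity>"
      using \<beta>0 by (auto simp: ennreal_mult_less_top)
    moreover have "(\<integral>\<^sup>+x. V x * (inverse c * G x) \<partial>M) = inverse c * (\<integral>\<^sup>+x. V x * G x \<partial>M)"
      by (simp add: mult.left_commute[of _ "inverse c"] nn_integral_cmult)
    ultimately show "(\<integral>\<^sup>+x. V x * (inverse c * G x) \<partial>M) < \<infinity>"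
      using ic by (simp add: ennreal_mult_less_top)
  qed measurable
qed

end

section \<open>Lebesgue measure on coordinates\<close>

lemma borel_measurable_vec_nth [measurable]:
  "(\<lambda>v::real^'n::finite. v $ k) \<in> borel_measurable borel"
  by (intro borel_measurable_continuous_onI continuous_intros)

lemma borel_measurable_vec_lambda [measurable (raw)]:
  fixes f :: "'a \<Rightarrow> 'n::finite \<Rightarrow> real"
  assumes [measurable]: "\<And>k. (\<lambda>x. f x k) \<in> borel_measurable M"
  shows "(\<lambda>x. \<chi> k. f x k) \<in> borel_measurable M"
proof (subst borel_measurable_euclidean_space, intro ballI)
  fix b :: "real^'n" assume "b \<in> Basis"
  then obtain k where "b = axis k 1" by (auto simp: Basis_vec_def)
  then show "(\<lambda>x. (\<chi> k. f x k) \<bullet> b) \<in> borel_measurable M"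
    by (simp add: inner_axis)
qed

lemma borel_measurable_vec_lambda_PiM [measurable]:
  "(vec_lambda :: ('n::finite \<Rightarrow> real) \<Rightarrow> real^'n) \<in> measurable (Pi\<^sub>M UNIV (\<lambda>_. lborel)) borel"
proof -
  have "(\<lambda>x::'n\<Rightarrow>real. \<chi> k. x k) \<in> measurable (Pi\<^sub>M UNIV (\<lambda>_. lborel)) borel" by measurable
  then show ?thesis by simp
qed

text \<open>Lebesgue measure is determined by the volumes of boxes, and a box in vector form is a
  product of intervals. The product form opens the way to integrating one coordinate at a
  time.\<close>

lemma lborel_vec: "(lborel :: (real^'n::finite) measure) = distr (Pi\<^sub>M UNIV (\<lambda>_. lborel)) borel vec_lambda"
proof (rule lborel_eqI)
  interpret product_sigma_finite "\<lambda>_::'n. lborel :: real measure" by standard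
  fix l u :: "real^'n" assume le: "\<And>b. b \<in> Basis \<Longrightarrow> l \<bullet> b \<le> u \<bullet> b"
  have le': "l $ k \<le> u $ k" for k using le[of "axis k 1"] by (simp add: inner_axis)
  have inj: "inj (\<lambda>k::'n. axis k (1::real))" by (auto simp: inj_on_def axis_eq_axis)
  have "(\<Prod>b\<in>Basis. (u - l) \<bullet> b) = (\<Prod>b\<in>range (\<lambda>k. axis k 1). (u - l) \<bullet> b)"
    by (intro prod.cong) (auto simp: Basis_vec_def)
  also have "\<dots> = (\<Prod>k\<in>UNIV. u $ k - l $ k)"
    by (subst prod.reindex[OF inj]) (simp add: inner_axis)
  finally have *: "(\<Prod>b\<in>Basis. (u - l) \<bullet> b) = (\<Prod>k\<in>UNIV. u $ k - l $ k)" .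
  have "emeasure (distr (Pi\<^sub>M UNIV (\<lambda>_. lborel)) borel vec_lambda) (box l u)
      = emeasure (Pi\<^sub>M UNIV (\<lambda>_::'n. lborel)) (Pi\<^sub>E UNIV (\<lambda>k. {l $ k <..< u $ k}))"
    by (subst emeasure_distr) (auto simp: space_PiM mem_box_cart PiE_iff intro!: arg_cong2[where f=emeasure])
  also have "\<dots> = (\<Prod>k\<in>UNIV. ennreal (u $ k - l $ k))"
    by (subst emeasure_PiM) (auto simp: le')
  also have "\<dots> = ennreal (\<Prod>k\<in>UNIV. u $ k - l $ k)"
    by (intro prod_ennreal) (auto simp: le')
  finally show "emeasure (distr (Pi\<^sub>M UNIV (\<lambda>_. lborel)) borel vec_lambda) (box l u) = ennreal (\<Prod>b\<in>Basis. (u - l) \<bullet> b)"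
    by (simp add: *)
qed simp

lemma nn_integral_lborel_vec:
  fixes f :: "real^'n::finite \<Rightarrow> ennreal"
  assumes [measurable]: "f \<in> borel_measurable borel"
  shows "(\<integral>\<^sup>+v. f v \<partial>lborel) = (\<integral>\<^sup>+x. f (vec_lambda x) \<partial>Pi\<^sub>M UNIV (\<lambda>_. lborel))"
  by (subst lborel_vec) (simp add: nn_integral_distr)

section \<open>Changing one coordinate at a time\<close>

definition upd :: "real^'n::finite \<Rightarrow> 'n \<Rightarrow> real \<Rightarrow> real^'n" where
  "upd v i x = (\<chi> k. if k = i then x else v $ k)"

lemma upd_nth [simp]: "upd v i x $ k = (if k = i then x else v $ k)"
  by (simp add: upd_def)

lemma upd_upd [simp]: "upd (upd v i x) i y = upd v i y"
  by (simp add: vec_eq_iff)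

lemma upd_self [simp]: "upd v i (v $ i) = v"
  by (simp add: vec_eq_iff)

lemma borel_measurable_upd [measurable (raw)]:
  assumes [measurable]: "f \<in> borel_measurable M" "g \<in> borel_measurable M"
  shows "(\<lambda>x. upd (f x) i (g x)) \<in> borel_measurable M"
  unfolding upd_def by measurable

text \<open>Exchanging coordinate \<open>i\<close> of \<open>v\<close> with the extra variable
  \<open>x\<close> permutes the axes of a space of dimension N + 1 and so preserves volume. Once
  coordinate \<open>i\<close> is split off, this is Fubini for two real variables.\<close>

lemma nn_integral_swap_coordinate:
  fixes h :: "real^'n::finite \<Rightarrow> real \<Rightarrow> ennreal"
  assumes [measurable]: "case_prod h \<in> borel_measurable (borel \<Otimes>\<^sub>M borel)"
  shows "(\<integral>\<^sup>+v. \<integral>\<^sup>+x. h (upd v i x) (v $ i) \<partial>lborel \<partial>lborel) = (\<integral>\<^sup>+v. \<integral>\<^sup>+x. h v x \<partial>lborel \<partial>lborel)"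
proof -
  interpret product_sigma_finite "\<lambda>_::'n. lborel :: real measure" by standard
  let ?I = "UNIV - {i}"
  have I: "insert i ?I = UNIV" by auto
  have iter: "(\<integral>\<^sup>+v. f v \<partial>lborel) = (\<integral>\<^sup>+z. \<integral>\<^sup>+y. f (vec_lambda (z(i := y))) \<partial>lborel \<partial>Pi\<^sub>M ?I (\<lambda>_. lborel))"
    if [measurable]: "f \<in> borel_measurable borel" for f :: "real^'n \<Rightarrow> ennreal"
    using product_nn_integral_insert[of ?I i "\<lambda>x. f (vec_lambda x)"]
    by (simp add: nn_integral_lborel_vec I)
  have u: "upd (vec_lambda (z(i := y))) i x = vec_lambda (z(i := x))" "vec_lambda (z(i := y)) $ i = y" for z x y
    by (auto simp: vec_eq_iff)
  have "(\<integral>\<^sup>+v. \<integral>\<^sup>+x. h (upd v i x) (v $ i) \<partial>lborel \<partial>lborel)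
      = (\<integral>\<^sup>+z. \<integral>\<^sup>+y. \<integral>\<^sup>+x. h (vec_lambda (z(i := x))) y \<partial>lborel \<partial>lborel \<partial>Pi\<^sub>M ?I (\<lambda>_. lborel))"
    by (subst iter) (simp_all only: u, measurable)
  also have "\<dots> = (\<integral>\<^sup>+z. \<integral>\<^sup>+x. \<integral>\<^sup>+y. h (vec_lambda (z(i := x))) y \<partial>lborel \<partial>lborel \<partial>Pi\<^sub>M ?I (\<lambda>_. lborel))"
  proof (rule nn_integral_cong)
    fix z
    have [measurable]: "(\<lambda>x. vec_lambda (z(i := x)) :: real^'n) \<in> borel_measurable borel"
      unfolding fun_upd_def by measurable
    show "(\<integral>\<^sup>+y. \<integral>\<^sup>+x. h (vec_lambda (z(i := x))) y \<partial>lborel \<partial>lborel) = (\<integral>\<^sup>+x. \<integral>\<^sup>+y. h (vec_lambda (z(i := x))) y \<partial>lborel \<partial>lborel)"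
      by (rule lborel_pair.Fubini') measurable
  qed
  also have "\<dots> = (\<integral>\<^sup>+v. \<integral>\<^sup>+x. h v x \<partial>lborel \<partial>lborel)"
    by (subst iter) simp_all
  finally show ?thesis .
qed

text \<open>The weight \<open>\<phi>\<close> replaces the integral over the remaining coordinates, so that no product
  measure over the other indices is needed.\<close>

lemma nn_integral_upd:
  fixes f :: "real^'n::finite \<Rightarrow> ennreal" and \<phi> :: "real \<Rightarrow> ennreal"
  assumes [measurable]: "f \<in> borel_measurable borel" "\<phi> \<in> borel_measurable borel"
    and \<phi>: "(\<integral>\<^sup>+x. \<phi> x \<partial>lborel) = 1"
  shows "(\<integral>\<^sup>+v. f v \<partial>lborel) = (\<integral>\<^sup>+v. \<phi> (v $ i) * (\<integral>\<^sup>+x. f (upd v i x) \<partial>lborel) \<partial>lborel)"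
proof -
  have "(\<integral>\<^sup>+v. f v \<partial>lborel) = (\<integral>\<^sup>+v. \<integral>\<^sup>+x. f v * \<phi> x \<partial>lborel \<partial>lborel)"
    by (simp add: nn_integral_cmult \<phi>)
  also have "\<dots> = (\<integral>\<^sup>+v. \<integral>\<^sup>+x. f (upd v i x) * \<phi> (v $ i) \<partial>lborel \<partial>lborel)"
    by (subst nn_integral_swap_coordinate[symmetric, where i=i]) simp_all
  also have "\<dots> = (\<integral>\<^sup>+v. \<phi> (v $ i) * (\<integral>\<^sup>+x. f (upd v i x) \<partial>lborel) \<partial>lborel)"
    by (simp add: nn_integral_cmult mult.commute)
  finally show ?thesis .
qed

text \<open>For \<open>c \<noteq> 0\<close> the rotation is carried out one variable at a time: an
  affine substitution in the first variable with factor \<open>c\<close>, then one in the second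
  with factor \<open>1 / c\<close>, and the Jacobians cancel. For \<open>c = 0\<close> it exchanges
  the axes up to signs.\<close>

lemma nn_integral_rotate:
  fixes f :: "real \<Rightarrow> real \<Rightarrow> ennreal"
  assumes [measurable]: "case_prod f \<in> borel_measurable (borel \<Otimes>\<^sub>M borel)"
    and cs: "c\<^sup>2 + s\<^sup>2 = 1"
  shows "(\<integral>\<^sup>+x. \<integral>\<^sup>+y. f (x * c + y * s) (y * c - x * s) \<partial>lborel \<partial>lborel) = (\<integral>\<^sup>+x. \<integral>\<^sup>+y. f x y \<partial>lborel \<partial>lborel)"
proof (cases "c = 0")
  case True
  then have s: "\<bar>s\<bar> = 1" "s \<noteq> 0" using cs by (auto simp: power2_eq_1_iff)
  have "(\<integral>\<^sup>+x. \<integral>\<^sup>+y. f (x * c + y * s) (y * c - x * s) \<partial>lborel \<partial>lborel) = (\<integral>\<^sup>+x. \<integral>\<^sup>+y. f y (- x * s) \<partial>lborel \<partial>lborel)"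
    using s nn_integral_real_affine[of "\<lambda>y. f y (- x * s)" s 0 for x] by (simp add: True mult.commute)
  also have "\<dots> = (\<integral>\<^sup>+y. \<integral>\<^sup>+x. f y (- x * s) \<partial>lborel \<partial>lborel)"
    by (rule lborel_pair.Fubini') measurable
  also have "\<dots> = (\<integral>\<^sup>+x. \<integral>\<^sup>+y. f x y \<partial>lborel \<partial>lborel)"
    using s nn_integral_real_affine[of "f y" "- s" 0 for y] by (simp add: mult.commute)
  finally show ?thesis .
next
  case False
  have inner: "ennreal \<bar>c\<bar> * (\<integral>\<^sup>+x. f (x * c + y * s) (y * c - x * s) \<partial>lborel) = (\<integral>\<^sup>+x. f x (- x * s / c + (1/c) * y) \<partial>lborel)" for y
  proof -
    have "y * c - x * s = - (y * s + c * x) * s / c + (1/c) * y" for x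
    proof -
      have "(y * c - x * s) * c = - (y * s + c * x) * s + y"
      proof -
        have "(y * c - x * s) * c = y * (c\<^sup>2 + s\<^sup>2) - (y * s + c * x) * s" by (simp add: algebra_simps power2_eq_square)
        then show ?thesis using cs by (simp add: algebra_simps)
      qed
      then show ?thesis using False by (simp add: field_simps)
    qed
    then show ?thesis
      using False nn_integral_real_affine[of "\<lambda>x. f x (- x * s / c + (1/c) * y)" c "y * s"]
      by (simp add: mult.commute add.commute)
  qed
  have "ennreal \<bar>c\<bar> * (\<integral>\<^sup>+x. \<integral>\<^sup>+y. f (x * c + y * s) (y * c - x * s) \<partial>lborel \<partial>lborel)
     = ennreal \<bar>c\<bar> * (\<integral>\<^sup>+y. \<integral>\<^sup>+x. f (x * c + y * s) (y * c - x * s) \<partial>lborel \<partial>lborel)"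
    by (subst lborel_pair.Fubini') simp_all
  also have "\<dots> = (\<integral>\<^sup>+y. \<integral>\<^sup>+x. f x (- x * s / c + (1/c) * y) \<partial>lborel \<partial>lborel)"
    by (simp add: nn_integral_cmult[symmetric] inner)
  also have "\<dots> = (\<integral>\<^sup>+x. \<integral>\<^sup>+y. f x (- x * s / c + (1/c) * y) \<partial>lborel \<partial>lborel)"
    by (rule lborel_pair.Fubini') measurable
  finally have 1: "ennreal \<bar>c\<bar> * (\<integral>\<^sup>+x. \<integral>\<^sup>+y. f (x * c + y * s) (y * c - x * s) \<partial>lborel \<partial>lborel)
    = (\<integral>\<^sup>+x. \<integral>\<^sup>+y. f x (- x * s / c + (1/c) * y) \<partial>lborel \<partial>lborel)" .
  have "(\<integral>\<^sup>+x. \<integral>\<^sup>+y. f x y \<partial>lborel \<partial>lborel)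
      = (\<integral>\<^sup>+x. ennreal \<bar>1/c\<bar> * (\<integral>\<^sup>+y. f x (- x * s / c + (1/c) * y) \<partial>lborel) \<partial>lborel)"
    using False by (intro nn_integral_cong nn_integral_real_affine) auto
  also have "\<dots> = ennreal \<bar>1/c\<bar> * (ennreal \<bar>c\<bar> * (\<integral>\<^sup>+x. \<integral>\<^sup>+y. f (x * c + y * s) (y * c - x * s) \<partial>lborel \<partial>lborel))"
    unfolding 1 by (rule nn_integral_cmult) measurable
  also have "\<dots> = ennreal (\<bar>1/c\<bar> * \<bar>c\<bar>) * (\<integral>\<^sup>+x. \<integral>\<^sup>+y. f (x * c + y * s) (y * c - x * s) \<partial>lborel \<partial>lborel)"
    by (subst ennreal_mult) (auto simp: mult.assoc)
  also have "\<bar>1/c\<bar> * \<bar>c\<bar> = 1" using False by (simp add: abs_mult[symmetric])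
  finally show ?thesis by simp
qed

section \<open>Collision operators\<close>

text \<open>Law of the scattering angle, set up as a measure so that averages over it can be
  exchanged with Lebesgue integrals by Fubini.\<close>

definition angle :: "real measure" where
  "angle = density lborel (\<lambda>\<theta>. ennreal (indicator {0..2*pi} \<theta> / (2*pi)))"

lemma sets_angle [simp, measurable_cong]: "sets angle = sets borel"
  by (simp add: angle_def)

lemma space_angle [simp]: "space angle = UNIV"
  by (simp add: angle_def)

lemma nn_integral_angle:
  assumes [measurable]: "f \<in> borel_measurable borel"
  shows "(\<integral>\<^sup>+\<theta>. f \<theta> \<partial>angle) = ennreal (1 / (2*pi)) * (\<integral>\<^sup>+\<theta>. f \<theta> * indicator {0..2*pi} \<theta> \<partial>lborel)"
  unfolding angle_def
  by (subst nn_integral_density, simp_all, subst nn_integral_cmult[symmetric])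
     (auto intro!: nn_integral_cong simp: indicator_def)

lemma emeasure_angle [simp]: "emeasure angle UNIV = 1"
proof -
  have "emeasure angle UNIV = (\<integral>\<^sup>+\<theta>. 1 \<partial>angle)" by simp
  also have "\<dots> = ennreal (1 / (2*pi)) * ennreal (2*pi)"
    by (subst nn_integral_angle) simp_all
  finally show ?thesis by (simp flip: ennreal_mult)
qed

interpretation angle: sigma_finite_measure angle
  by (rule finite_measure.axioms(1), rule finite_measureI) simp

interpretation lborel_angle: pair_sigma_finite "lborel :: 'a::euclidean_space measure" angle ..

lemma pair_rot_upd:
  "pair_rot i j \<theta> v = upd (upd v j (v $ j * cos \<theta> - v $ i * sin \<theta>)) i (v $ i * cos \<theta> + v $ j * sin \<theta>)"
  by (simp add: pair_rot_def vec_eq_iff)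

lemma therm_rot_upd: "therm_rot j w \<theta> v = upd v j (v $ j * cos \<theta> + w * sin \<theta>)"
  by (simp add: therm_rot_def vec_eq_iff)

lemma measurable_pair_rot [measurable (raw)]:
  assumes [measurable]: "f \<in> borel_measurable M" "g \<in> borel_measurable M"
  shows "(\<lambda>x. pair_rot i j (g x) (f x)) \<in> borel_measurable M"
  unfolding pair_rot_upd by measurable

lemma pair_rot_cancel:
  assumes "i \<noteq> j"
  shows "pair_rot i j (-\<theta>) (pair_rot i j \<theta> v) = v"
proof -
  have cs: "cos \<theta> * cos \<theta> + sin \<theta> * sin \<theta> = 1" using sin_cos_squared_add3[of \<theta>] by simp
  then have "(a * cos \<theta> + b * sin \<theta>) * cos \<theta> - (b * cos \<theta> - a * sin \<theta>) * sin \<theta> = a"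
       "(b * cos \<theta> - a * sin \<theta>) * cos \<theta> + (a * cos \<theta> + b * sin \<theta>) * sin \<theta> = b" for a b
    by algebra+
  then show ?thesis using assms by (simp add: pair_rot_upd vec_eq_iff)
qed

lemma nn_integral_pair_rot:
  fixes f :: "real^'n::{finite,linorder} \<Rightarrow> ennreal"
  assumes [measurable]: "f \<in> borel_measurable borel" and ij: "i \<noteq> j"
  shows "(\<integral>\<^sup>+v. f (pair_rot i j \<theta> v) \<partial>lborel) = (\<integral>\<^sup>+v. f v \<partial>lborel)"
proof -
  \<comment> \<open>Any probability density would serve; it is only the normalizing weight for
    \<open>nn_integral_upd\<close>, applied once in each of the two rotated coordinates.\<close>
  define \<phi> :: "real \<Rightarrow> ennreal" where "\<phi> = indicator {0..1}"
  have [measurable]: "\<phi> \<in> borel_measurable borel" and \<phi>: "(\<integral>\<^sup>+x. \<phi> x \<partial>lborel) = 1"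
    by (auto simp: \<phi>_def)
  have iter: "(\<integral>\<^sup>+v. F v \<partial>lborel) = (\<integral>\<^sup>+v. \<phi> (v $ j) * \<phi> (v $ i) * (\<integral>\<^sup>+y. \<integral>\<^sup>+x. F (upd (upd v j y) i x) \<partial>lborel \<partial>lborel) \<partial>lborel)"
    if [measurable]: "F \<in> borel_measurable borel" for F :: "(real, 'n) vec \<Rightarrow> ennreal"
    using ij by (subst nn_integral_upd[OF that _ \<phi>, of i], simp, subst nn_integral_upd[OF _ _ \<phi>, of _ j])
      (simp_all add: nn_integral_cmult mult.assoc)
  have "pair_rot i j \<theta> (upd (upd v j y) i x) = upd (upd v j (y * cos \<theta> - x * sin \<theta>)) i (x * cos \<theta> + y * sin \<theta>)" for v x y
    using ij by (simp add: pair_rot_upd vec_eq_iff)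
  moreover have "(\<integral>\<^sup>+y. \<integral>\<^sup>+x. f (upd (upd v j (y * cos \<theta> - x * sin \<theta>)) i (x * cos \<theta> + y * sin \<theta>)) \<partial>lborel \<partial>lborel)
      = (\<integral>\<^sup>+y. \<integral>\<^sup>+x. f (upd (upd v j y) i x) \<partial>lborel \<partial>lborel)" for v
  proof -
    have "(\<integral>\<^sup>+y. \<integral>\<^sup>+x. f (upd (upd v j (y * cos \<theta> - x * sin \<theta>)) i (x * cos \<theta> + y * sin \<theta>)) \<partial>lborel \<partial>lborel)
        = (\<integral>\<^sup>+x. \<integral>\<^sup>+y. f (upd (upd v j (y * cos \<theta> - x * sin \<theta>)) i (x * cos \<theta> + y * sin \<theta>)) \<partial>lborel \<partial>lborel)"
      by (rule lborel_pair.Fubini') measurable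
    also have "\<dots> = (\<integral>\<^sup>+x. \<integral>\<^sup>+y. f (upd (upd v j y) i x) \<partial>lborel \<partial>lborel)"
      by (rule nn_integral_rotate[where f="\<lambda>x y. f (upd (upd v j y) i x)"]) auto
    also have "\<dots> = (\<integral>\<^sup>+y. \<integral>\<^sup>+x. f (upd (upd v j y) i x) \<partial>lborel \<partial>lborel)"
      by (rule lborel_pair.Fubini') measurable
    finally show ?thesis .
  qed
  ultimately show ?thesis by (subst (1 2) iter) simp_all
qed

text \<open>The pair formed by \<open>v $ j\<close> and \<open>w\<close> undergoes a plane rotation,
  so a thermostat collision preserves volume once the thermostat velocity is counted as an
  additional coordinate.\<close>

lemma nn_integral_therm_rot:
  fixes H :: "real^'n::{finite,linorder} \<Rightarrow> real \<Rightarrow> ennreal"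
  assumes [measurable]: "case_prod H \<in> borel_measurable (borel \<Otimes>\<^sub>M borel)"
  shows "(\<integral>\<^sup>+v. \<integral>\<^sup>+w. H (therm_rot j w \<theta> v) (w * cos \<theta> - v $ j * sin \<theta>) \<partial>lborel \<partial>lborel)
       = (\<integral>\<^sup>+v. \<integral>\<^sup>+w. H v w \<partial>lborel \<partial>lborel)"
proof -
  define \<phi> :: "real \<Rightarrow> ennreal" where "\<phi> = indicator {0..1}"
  have [measurable]: "\<phi> \<in> borel_measurable borel" and \<phi>: "(\<integral>\<^sup>+x. \<phi> x \<partial>lborel) = 1"
    by (auto simp: \<phi>_def)
  have "(\<integral>\<^sup>+v. \<integral>\<^sup>+w. H (therm_rot j w \<theta> v) (w * cos \<theta> - v $ j * sin \<theta>) \<partial>lborel \<partial>lborel)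
     = (\<integral>\<^sup>+v. \<phi> (v $ j) * (\<integral>\<^sup>+x. \<integral>\<^sup>+w. H (upd v j (x * cos \<theta> + w * sin \<theta>)) (w * cos \<theta> - x * sin \<theta>) \<partial>lborel \<partial>lborel) \<partial>lborel)"
    unfolding therm_rot_upd by (subst nn_integral_upd[OF _ _ \<phi>, of _ j]) simp_all
  also have "\<dots> = (\<integral>\<^sup>+v. \<phi> (v $ j) * (\<integral>\<^sup>+x. \<integral>\<^sup>+w. H (upd v j x) w \<partial>lborel \<partial>lborel) \<partial>lborel)"
    by (subst nn_integral_rotate[where f="\<lambda>x w. H (upd v j x) w" for v]) simp_all
  also have "\<dots> = (\<integral>\<^sup>+v. \<integral>\<^sup>+w. H v w \<partial>lborel \<partial>lborel)"
    by (subst (2) nn_integral_upd[OF _ _ \<phi>, of _ j]) simp_all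
  finally show ?thesis .
qed

section \<open>Gain operators of single collisions and their duals\<close>

definition pair_gain :: "'n::{finite,linorder} \<Rightarrow> 'n \<Rightarrow> (real^'n::{finite,linorder} \<Rightarrow> ennreal) \<Rightarrow> real^'n::{finite,linorder} \<Rightarrow> ennreal" where
  "pair_gain i j f v = (\<integral>\<^sup>+\<theta>. f (pair_rot i j \<theta> v) \<partial>angle)"

definition pair_gain_dual :: "'n::{finite,linorder} \<Rightarrow> 'n \<Rightarrow> (real^'n::{finite,linorder} \<Rightarrow> ennreal) \<Rightarrow> real^'n::{finite,linorder} \<Rightarrow> ennreal" where
  "pair_gain_dual i j h v = (\<integral>\<^sup>+\<theta>. h (pair_rot i j (-\<theta>) v) \<partial>angle)"

definition therm_gain :: "(real \<Rightarrow> real) \<Rightarrow> 'n::{finite,linorder} \<Rightarrow> (real^'n::{finite,linorder} \<Rightarrow> ennreal) \<Rightarrow> real^'n::{finite,linorder} \<Rightarrow> ennreal" where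
  "therm_gain g j f v = (\<integral>\<^sup>+w. \<integral>\<^sup>+\<theta>. ennreal (g (w * cos \<theta> - v $ j * sin \<theta>)) * f (therm_rot j w \<theta> v) \<partial>angle \<partial>lborel)"

text \<open>Expected value of \<open>h\<close> after particle \<open>j\<close> has met a thermostat
  particle whose velocity \<open>w\<close> has law \<open>g\<close>. The minus sign is that of the
  inverse rotation.\<close>

definition therm_gain_dual :: "(real \<Rightarrow> real) \<Rightarrow> 'n::{finite,linorder} \<Rightarrow> (real^'n::{finite,linorder} \<Rightarrow> ennreal) \<Rightarrow> real^'n::{finite,linorder} \<Rightarrow> ennreal" where
  "therm_gain_dual g j h v = (\<integral>\<^sup>+w. ennreal (g w) * (\<integral>\<^sup>+\<theta>. h (upd v j (v $ j * cos \<theta> - w * sin \<theta>)) \<partial>angle) \<partial>lborel)"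

lemma measurable_gain [measurable]:
  fixes f :: "real^'n::{finite,linorder} \<Rightarrow> ennreal"
  assumes [measurable]: "f \<in> borel_measurable borel" "g \<in> borel_measurable borel"
  shows "pair_gain i j f \<in> borel_measurable borel" "pair_gain_dual i j f \<in> borel_measurable borel"
    "therm_gain g k f \<in> borel_measurable borel" "therm_gain_dual g k f \<in> borel_measurable borel"
  unfolding pair_gain_def pair_gain_dual_def therm_gain_def therm_gain_dual_def therm_rot_upd
  by measurable

lemma pair_gain_duality:
  fixes f h :: "real^'n::{finite,linorder} \<Rightarrow> ennreal"
  assumes [measurable]: "f \<in> borel_measurable borel" "h \<in> borel_measurable borel" and ij: "i \<noteq> j"
  shows "(\<integral>\<^sup>+v. h v * pair_gain i j f v \<partial>lborel) = (\<integral>\<^sup>+v. pair_gain_dual i j h v * f v \<partial>lborel)"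
proof -
  have "(\<integral>\<^sup>+v. h v * pair_gain i j f v \<partial>lborel) = (\<integral>\<^sup>+v. \<integral>\<^sup>+\<theta>. h v * f (pair_rot i j \<theta> v) \<partial>angle \<partial>lborel)"
    by (simp add: pair_gain_def nn_integral_cmult)
  also have "\<dots> = (\<integral>\<^sup>+\<theta>. \<integral>\<^sup>+v. h v * f (pair_rot i j \<theta> v) \<partial>lborel \<partial>angle)"
    by (rule lborel_angle.Fubini'[symmetric]) measurable
  also have "\<dots> = (\<integral>\<^sup>+\<theta>. \<integral>\<^sup>+v. h (pair_rot i j (-\<theta>) v) * f v \<partial>lborel \<partial>angle)"
    using nn_integral_pair_rot[of "\<lambda>v. h (pair_rot i j (-\<theta>) v) * f v" i j \<theta> for \<theta>] ij
    by (simp add: pair_rot_cancel)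
  also have "\<dots> = (\<integral>\<^sup>+v. \<integral>\<^sup>+\<theta>. h (pair_rot i j (-\<theta>) v) * f v \<partial>angle \<partial>lborel)"
    by (rule lborel_angle.Fubini') measurable
  finally show ?thesis by (simp add: pair_gain_dual_def nn_integral_multc)
qed

lemma therm_gain_duality:
  fixes f h :: "real^'n::{finite,linorder} \<Rightarrow> ennreal"
  assumes [measurable]: "f \<in> borel_measurable borel" "h \<in> borel_measurable borel" "g \<in> borel_measurable borel"
  shows "(\<integral>\<^sup>+v. h v * therm_gain g j f v \<partial>lborel) = (\<integral>\<^sup>+v. therm_gain_dual g j h v * f v \<partial>lborel)"
proof -
  \<comment> \<open>Integrand of the dual side. At the rotated arguments it becomes the integrand of
    the original side, because the inverse rotation restores \<open>v $ j\<close> inside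
    \<open>h\<close>.\<close>
  define H where "H \<theta> v w = ennreal (g w) * f v * h (upd v j (v $ j * cos \<theta> - w * sin \<theta>))" for \<theta> v w
  have [measurable]: "(\<lambda>x. H (a x) (b x) (c x)) \<in> borel_measurable M"
    if [measurable]: "a \<in> borel_measurable M" "b \<in> borel_measurable M" "c \<in> borel_measurable M" 
    for a b c and M :: "'b measure"
    unfolding H_def by measurable
  have H: "H \<theta> (therm_rot j w \<theta> v) (w * cos \<theta> - v $ j * sin \<theta>)
      = h v * (ennreal (g (w * cos \<theta> - v $ j * sin \<theta>)) * f (therm_rot j w \<theta> v))" for \<theta> v w
  proof -
    have "(v $ j * cos \<theta> + w * sin \<theta>) * cos \<theta> - (w * cos \<theta> - v $ j * sin \<theta>) * sin \<theta> = v $ j"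
      using sin_cos_squared_add3[of \<theta>] by algebra
    then show ?thesis by (simp add: H_def therm_rot_upd ac_simps)
  qed
  have "(\<integral>\<^sup>+v. h v * therm_gain g j f v \<partial>lborel) = (\<integral>\<^sup>+v. \<integral>\<^sup>+w. \<integral>\<^sup>+\<theta>. H \<theta> (therm_rot j w \<theta> v) (w * cos \<theta> - v $ j * sin \<theta>) \<partial>angle \<partial>lborel \<partial>lborel)"
    unfolding H unfolding therm_gain_def therm_rot_upd by (simp add: nn_integral_cmult)
  also have "\<dots> = (\<integral>\<^sup>+v. \<integral>\<^sup>+\<theta>. \<integral>\<^sup>+w. H \<theta> (therm_rot j w \<theta> v) (w * cos \<theta> - v $ j * sin \<theta>) \<partial>lborel \<partial>angle \<partial>lborel)"
    unfolding therm_rot_upd by (intro nn_integral_cong lborel_angle.Fubini'[symmetric]) measurable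
  also have "\<dots> = (\<integral>\<^sup>+\<theta>. \<integral>\<^sup>+v. \<integral>\<^sup>+w. H \<theta> (therm_rot j w \<theta> v) (w * cos \<theta> - v $ j * sin \<theta>) \<partial>lborel \<partial>lborel \<partial>angle)"
    unfolding therm_rot_upd by (intro lborel_angle.Fubini'[symmetric]) measurable
  also have "\<dots> = (\<integral>\<^sup>+\<theta>. \<integral>\<^sup>+v. \<integral>\<^sup>+w. H \<theta> v w \<partial>lborel \<partial>lborel \<partial>angle)"
    by (intro nn_integral_cong nn_integral_therm_rot) measurable
  also have "\<dots> = (\<integral>\<^sup>+v. \<integral>\<^sup>+\<theta>. \<integral>\<^sup>+w. H \<theta> v w \<partial>lborel \<partial>angle \<partial>lborel)"
    by (intro lborel_angle.Fubini') measurable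
  also have "\<dots> = (\<integral>\<^sup>+v. \<integral>\<^sup>+w. \<integral>\<^sup>+\<theta>. H \<theta> v w \<partial>angle \<partial>lborel \<partial>lborel)"
    by (intro nn_integral_cong lborel_angle.Fubini') measurable
  also have "\<dots> = (\<integral>\<^sup>+v. therm_gain_dual g j h v * f v \<partial>lborel)"
    unfolding H_def therm_gain_dual_def
    by (simp add: nn_integral_cmult mult.assoc mult.left_commute[of _ "f _"])
       (simp add: nn_integral_cmult mult.commute)
  finally show ?thesis .
qed

definition pairs :: "('n::{finite,linorder} \<times> 'n) set" where
  "pairs = {p. fst p < snd p}"

lemma finite_pairs [simp]: "finite pairs"
  by (rule finite_subset[of _ UNIV]) auto

lemma pairs_neq: "p \<in> pairs \<Longrightarrow> fst p \<noteq> snd p"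
  by (auto simp: pairs_def)

text \<open>Identifies the normalization of \<open>kacQ\<close> with an average over
  \<open>pairs\<close>: an increasing pair is the same thing as a two-element subset.\<close>

lemma card_pairs: "card (pairs :: ('n::{finite,linorder} \<times> 'n) set) = CARD('n) choose 2"
proof -
  have "bij_betw (\<lambda>p. {fst p, snd p}) (pairs :: ('n \<times> 'n) set) {A. A \<subseteq> UNIV \<and> card A = 2}"
  proof (rule bij_betwI')
    fix p q :: "'n \<times> 'n" assume "p \<in> pairs" "q \<in> pairs"
    then show "({fst p, snd p} = {fst q, snd q}) = (p = q)"
      by (auto simp: pairs_def doubleton_eq_iff prod_eq_iff)
  next
    fix p :: "'n \<times> 'n" assume "p \<in> pairs"
    then show "{fst p, snd p} \<in> {A. A \<subseteq> UNIV \<and> card A = 2}" by (auto simp: pairs_def)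
  next
    fix A :: "'n set" assume "A \<in> {A. A \<subseteq> UNIV \<and> card A = 2}"
    then obtain x y where "A = {x, y}" "x \<noteq> y" by (auto simp: card_2_iff)
    then show "\<exists>p\<in>pairs. A = {fst p, snd p}"
      by (cases "x < y") (force simp: pairs_def insert_commute)+
  qed
  then have "card (pairs :: ('n \<times> 'n) set) = card {A. A \<subseteq> (UNIV :: 'n set) \<and> card A = 2}"
    by (rule bij_betw_same_card)
  also have "\<dots> = CARD('n) choose 2" by (rule n_subsets) simp
  finally show ?thesis .
qed

section \<open>Averages over the scattering angle\<close>

text \<open>On \<open>[\<psi> - pi, \<psi>]\<close> the map
  \<open>r * cos (\<theta> - \<psi>)\<close> increases from \<open>-r\<close> to \<open>r\<close>
  with derivative at most \<open>r\<close>. The range of \<open>\<psi>\<close> places this half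
  period inside \<open>[0, 2*pi]\<close>.\<close>

lemma nn_integral_cos_shift_ge:
  fixes h :: "real \<Rightarrow> ennreal"
  assumes [measurable]: "h \<in> borel_measurable borel" and r: "0 < r" and \<psi>: "pi \<le> \<psi>" "\<psi> \<le> 2*pi"
  shows "(\<integral>\<^sup>+y. h y * indicator {-r..r} y \<partial>lborel) \<le> ennreal r * (\<integral>\<^sup>+\<theta>. h (r * cos (\<theta> - \<psi>)) * indicator {0..2*pi} \<theta> \<partial>lborel)"
proof -
  have "(\<integral>\<^sup>+y. h y * indicator {-r..r} y \<partial>lborel)
      = (\<integral>\<^sup>+y. h y * indicator {r * cos (\<psi> - pi - \<psi>)..r * cos (\<psi> - \<psi>)} y \<partial>lborel)"
    by simp
  also have "\<dots> = (\<integral>\<^sup>+\<theta>. h (r * cos (\<theta> - \<psi>)) * ennreal (r * sin (\<psi> - \<theta>)) * indicator {\<psi> - pi..\<psi>} \<theta> \<partial>lborel)"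
  proof (rule nn_integral_substitution_aux)
    fix \<theta> assume \<theta>: "\<theta> \<in> {\<psi> - pi..\<psi>}"
    have "sin (\<psi> - \<theta>) = - sin (\<theta> - \<psi>)" by (metis minus_diff_eq sin_minus)
    then show "((\<lambda>\<theta>. r * cos (\<theta> - \<psi>)) has_real_derivative r * sin (\<psi> - \<theta>)) (at \<theta>)"
      by (auto intro!: derivative_eq_intros)
    show "0 \<le> r * sin (\<psi> - \<theta>)" using \<theta> r by (auto intro!: mult_nonneg_nonneg sin_ge_zero)
  qed (auto intro!: continuous_intros)
  also have "\<dots> \<le> (\<integral>\<^sup>+\<theta>. ennreal r * (h (r * cos (\<theta> - \<psi>)) * indicator {0..2*pi} \<theta>) \<partial>lborel)"
  proof (rule nn_integral_mono)
    fix \<theta>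
    have "h (r * cos (\<theta> - \<psi>)) * ennreal (r * sin (\<psi> - \<theta>)) \<le> h (r * cos (\<theta> - \<psi>)) * ennreal r"
      using r by (intro mult_left_mono ennreal_leI) (auto simp: mult_left_le)
    then show "h (r * cos (\<theta> - \<psi>)) * ennreal (r * sin (\<psi> - \<theta>)) * indicator {\<psi> - pi..\<psi>} \<theta>
        \<le> ennreal r * (h (r * cos (\<theta> - \<psi>)) * indicator {0..2*pi} \<theta>)"
      using \<psi> by (auto simp: indicator_def mult.commute)
  qed
  also have "\<dots> = ennreal r * (\<integral>\<^sup>+\<theta>. h (r * cos (\<theta> - \<psi>)) * indicator {0..2*pi} \<theta> \<partial>lborel)"
    by (rule nn_integral_cmult) measurable
  finally show ?thesis .
qed

text \<open>In polar coordinates the outgoing velocity is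
  \<open>r * cos (\<theta> - \<phi>)\<close>. Only one monotone branch of the cosine is kept, which
  gives half of the bound \<open>1 / (pi * r)\<close> that both branches together would
  give.\<close>

lemma nn_integral_angle_ge:
  fixes h :: "real \<Rightarrow> ennreal"
  assumes [measurable]: "h \<in> borel_measurable borel" and r: "0 < r" and xw: "x\<^sup>2 + w\<^sup>2 = r\<^sup>2"
  shows "ennreal (1 / (2*pi*r)) * (\<integral>\<^sup>+y. h y * indicator {-r..r} y \<partial>lborel) \<le> (\<integral>\<^sup>+\<theta>. h (x * cos \<theta> - w * sin \<theta>) \<partial>angle)"
proof -
  have "(x/r)\<^sup>2 + (-w/r)\<^sup>2 = 1" using r xw by (simp add: power_divide flip: add_divide_distrib)
  then obtain \<phi> where \<phi>: "0 \<le> \<phi>" "\<phi> < 2*pi" "x/r = cos \<phi>" "-w/r = sin \<phi>"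
    using sincos_total_2pi by metis
  have y: "x * cos \<theta> - w * sin \<theta> = r * cos (\<theta> - \<phi>)" for \<theta>
  proof -
    have "x = r * cos \<phi>" "- w = r * sin \<phi>" using \<phi> r by (simp_all add: field_simps)
    then have "r * cos (\<theta> - \<phi>) = cos \<theta> * x + sin \<theta> * (- w)" by (simp add: cos_diff algebra_simps)
    then show ?thesis by (simp add: algebra_simps)
  qed
  have "(\<integral>\<^sup>+y. h y * indicator {-r..r} y \<partial>lborel) \<le> ennreal r * (\<integral>\<^sup>+\<theta>. h (r * cos (\<theta> - \<phi>)) * indicator {0..2*pi} \<theta> \<partial>lborel)"
  \<comment> \<open>The half period has to lie in \<open>[0, 2*pi]\<close>. For a phase below
    \<open>pi\<close> the reflection of \<open>y\<close> to \<open>- y\<close> adds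
    \<open>pi\<close> to the phase.\<close>
  proof (cases "pi \<le> \<phi>")
    case True
    then show ?thesis using \<phi> by (intro nn_integral_cos_shift_ge r) auto
  next
    case False
    have "(\<integral>\<^sup>+y. h y * indicator {-r..r} y \<partial>lborel) = (\<integral>\<^sup>+y. h (- y) * indicator {-r..r} y \<partial>lborel)"
      using nn_integral_real_affine[of "\<lambda>y. h y * indicator {-r..r} y" "-1" 0]
      by (simp add: indicator_def minus_le_iff le_minus_iff conj_commute)
    also have "\<dots> \<le> ennreal r * (\<integral>\<^sup>+\<theta>. h (- (r * cos (\<theta> - (\<phi> + pi)))) * indicator {0..2*pi} \<theta> \<partial>lborel)"
      using False \<phi> by (intro nn_integral_cos_shift_ge[where h="\<lambda>y. h (- y)"] r) auto
    finally show ?thesis using cos_minus_pi[of "\<theta> - \<phi>" for \<theta>] by (simp add: diff_diff_eq)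
  qed
  then have "ennreal (1 / (2*pi*r)) * (\<integral>\<^sup>+y. h y * indicator {-r..r} y \<partial>lborel)
     \<le> ennreal (1 / (2*pi*r)) * (ennreal r * (\<integral>\<^sup>+\<theta>. h (r * cos (\<theta> - \<phi>)) * indicator {0..2*pi} \<theta> \<partial>lborel))"
    by (rule mult_left_mono) simp
  also have "\<dots> = (\<integral>\<^sup>+\<theta>. h (r * cos (\<theta> - \<phi>)) \<partial>angle)"
    using r by (subst nn_integral_angle) (simp_all flip: mult.assoc ennreal_mult)
  finally show ?thesis by (simp add: y)
qed

text \<open>The lower cutoff keeps the radius \<open>r\<close> of the circle at least
  \<open>\<delta>\<close>, so the outgoing velocity covers \<open>[-\<delta>, \<delta>]\<close> even
  when \<open>v $ j = 0\<close>; the upper cutoff keeps \<open>r \<le> R + m\<close> and bounds the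
  density from below. The interval does not depend on \<open>R\<close>, only the constant
  does.\<close>

lemma therm_gain_dual_ge:
  fixes h :: "real^'n::{finite,linorder} \<Rightarrow> ennreal"
  assumes [measurable]: "h \<in> borel_measurable borel" "g \<in> borel_measurable borel"
    and d: "0 < \<delta>" and R: "0 \<le> R" "\<bar>v $ j\<bar> \<le> R" and m: "0 \<le> m"
  shows "ennreal (1 / (2*pi*(R + m))) * (\<integral>\<^sup>+w. ennreal (g w) * indicator {w. \<delta> \<le> \<bar>w\<bar> \<and> \<bar>w\<bar> \<le> m} w \<partial>lborel)
       * (\<integral>\<^sup>+y. h (upd v j y) * indicator {-\<delta>..\<delta>} y \<partial>lborel) \<le> therm_gain_dual g j h v"
proof -
  let ?I = "\<integral>\<^sup>+y. h (upd v j y) * indicator {-\<delta>..\<delta>} y \<partial>lborel"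
  let ?k = "ennreal (1 / (2*pi*(R + m)))"
  let ?A = "{w. \<delta> \<le> \<bar>w\<bar> \<and> \<bar>w\<bar> \<le> m}"
  have "?k * (\<integral>\<^sup>+w. ennreal (g w) * indicator ?A w \<partial>lborel) * ?I = (?k * ?I) * (\<integral>\<^sup>+w. ennreal (g w) * indicator ?A w \<partial>lborel)"
    by (simp add: ac_simps)
  also have "\<dots> = (\<integral>\<^sup>+w. (?k * ?I) * (ennreal (g w) * indicator ?A w) \<partial>lborel)"
    by (rule nn_integral_cmult[symmetric]) measurable
  also have "\<dots> \<le> therm_gain_dual g j h v"
    unfolding therm_gain_dual_def
  proof (rule nn_integral_mono)
    fix w
    have "?k * ?I \<le> (\<integral>\<^sup>+\<theta>. h (upd v j (v $ j * cos \<theta> - w * sin \<theta>)) \<partial>angle)" if w: "w \<in> ?A"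
    proof -
      define r where "r = sqrt ((v $ j)\<^sup>2 + w\<^sup>2)"
      have r2: "(v $ j)\<^sup>2 + w\<^sup>2 = r\<^sup>2" by (simp add: r_def)
      have "\<bar>w\<bar> \<le> r" unfolding r_def by (rule real_le_rsqrt) simp
      then have r: "\<delta> \<le> r" "0 < r" using w d by auto
      have "r \<le> \<bar>v $ j\<bar> + \<bar>w\<bar>" unfolding r_def by (rule sqrt_sum_squares_le_sum_abs)
      then have rR: "r \<le> R + m" using R w by auto
      have "?k * ?I \<le> ennreal (1 / (2*pi*r)) * (\<integral>\<^sup>+y. h (upd v j y) * indicator {-r..r} y \<partial>lborel)"
        using r rR by (intro mult_mono ennreal_leI nn_integral_mono)
          (auto simp: indicator_def intro!: divide_left_mono mult_left_mono)
      also have "\<dots> \<le> (\<integral>\<^sup>+\<theta>. h (upd v j (v $ j * cos \<theta> - w * sin \<theta>)) \<partial>angle)"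
        by (rule nn_integral_angle_ge[OF _ r(2) r2, of "\<lambda>y. h (upd v j y)"]) measurable
      finally show ?thesis .
    qed
    then show "(?k * ?I) * (ennreal (g w) * indicator ?A w) \<le> ennreal (g w) * (\<integral>\<^sup>+\<theta>. h (upd v j (v $ j * cos \<theta> - w * sin \<theta>)) \<partial>angle)"
      by (auto simp: indicator_def mult.commute[of _ "ennreal (g w)"] intro!: mult_left_mono)
  qed
  finally show ?thesis .
qed

lemma nn_integral_angle_square:
  assumes E: "0 \<le> E"
  shows "(\<integral>\<^sup>+\<theta>. ennreal ((B + A * cos \<theta> + D * sin \<theta>)\<^sup>2 + E) \<partial>angle) = ennreal (B\<^sup>2 + (A\<^sup>2 + D\<^sup>2) / 2 + E)"
proof -
  \<comment> \<open>An antiderivative of the integrand. Its trigonometric terms are periodic, so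
    only the terms linear in \<open>\<theta>\<close> survive between 0 and
    \<open>2*pi\<close>.\<close>
  define F where "F \<theta> = B\<^sup>2 * \<theta> + A\<^sup>2 / 2 * (\<theta> + sin \<theta> * cos \<theta>) + D\<^sup>2 / 2 * (\<theta> - sin \<theta> * cos \<theta>)
     + 2 * B * A * sin \<theta> - 2 * B * D * cos \<theta> + A * D * (sin \<theta>)\<^sup>2 + E * \<theta>" for \<theta>
  have "(F has_real_derivative (B + A * cos \<theta> + D * sin \<theta>)\<^sup>2 + E) (at \<theta>)" for \<theta>
  proof -
    have "(F has_real_derivative B\<^sup>2 + A\<^sup>2 / 2 * (1 + (cos \<theta> * cos \<theta> - sin \<theta> * sin \<theta>)) + D\<^sup>2 / 2 * (1 - (cos \<theta> * cos \<theta> - sin \<theta> * sin \<theta>))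
      + 2 * B * A * cos \<theta> + 2 * B * D * sin \<theta> + A * D * (2 * sin \<theta> * cos \<theta>) + E) (at \<theta>)"
      unfolding F_def by (auto intro!: derivative_eq_intros simp: field_simps)
    moreover have c: "1 + (cos \<theta> * cos \<theta> - sin \<theta> * sin \<theta>) = 2 * (cos \<theta>)\<^sup>2" "1 - (cos \<theta> * cos \<theta> - sin \<theta> * sin \<theta>) = 2 * (sin \<theta>)\<^sup>2"
      using sin_cos_squared_add3[of \<theta>] by algebra+
    moreover have "B\<^sup>2 + A\<^sup>2 / 2 * (2 * (cos \<theta>)\<^sup>2) + D\<^sup>2 / 2 * (2 * (sin \<theta>)\<^sup>2)
      + 2 * B * A * cos \<theta> + 2 * B * D * sin \<theta> + A * D * (2 * sin \<theta> * cos \<theta>) + E = (B + A * cos \<theta> + D * sin \<theta>)\<^sup>2 + E"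
      by (simp add: power2_eq_square algebra_simps)
    ultimately show ?thesis by (simp only:)
  qed
  then have "(\<integral>\<^sup>+\<theta>. ennreal ((B + A * cos \<theta> + D * sin \<theta>)\<^sup>2 + E) * indicator {0..2*pi} \<theta> \<partial>lborel) = F (2*pi) - F 0"
    using E by (intro nn_integral_FTC_Icc) auto
  also have "F (2*pi) - F 0 = 2 * pi * (B\<^sup>2 + (A\<^sup>2 + D\<^sup>2) / 2 + E)"
    by (simp add: F_def field_simps)
  finally show ?thesis
    by (subst nn_integral_angle) (simp_all flip: ennreal_mult')
qed

lemma nn_integral_second_moment:
  fixes g :: "real \<Rightarrow> real"
  assumes nn: "\<And>w. 0 \<le> g w" and int: "integrable lborel g" "integrable lborel (\<lambda>w. w\<^sup>2 * g w)"
    and mass: "(\<integral>w. g w \<partial>lborel) = 1" and BD: "0 \<le> B" "0 \<le> D"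
  shows "(\<integral>\<^sup>+w. ennreal (g w) * ennreal (B + D * w\<^sup>2) \<partial>lborel) = ennreal (B + D * (\<integral>w. w\<^sup>2 * g w \<partial>lborel))"
proof -
  have "(\<integral>\<^sup>+w. ennreal (g w) * ennreal (B + D * w\<^sup>2) \<partial>lborel) = (\<integral>\<^sup>+w. ennreal (B * g w + D * (w\<^sup>2 * g w)) \<partial>lborel)"
    using nn BD by (intro nn_integral_cong) (simp add: algebra_simps flip: ennreal_mult)
  also have "\<dots> = ennreal (\<integral>w. B * g w + D * (w\<^sup>2 * g w) \<partial>lborel)"
    using int nn BD by (intro nn_integral_eq_integral) auto
  also have "(\<integral>w. B * g w + D * (w\<^sup>2 * g w) \<partial>lborel) = B + D * (\<integral>w. w\<^sup>2 * g w \<partial>lborel)"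
    using int by (simp add: mass)
  finally show ?thesis .
qed

section \<open>The gain operator of the Kac model\<close>

text \<open>With \<open>lam = r * a\<close> and \<open>mu = r * b\<close>, where
  \<open>a + b = 1\<close>, the operator \<open>kacL\<close> is formally \<open>r * N\<close> times
  this gain minus the identity. The weights are the probabilities that the next collision is with
  another particle or with the thermostat.\<close>

definition kac_gain :: "real \<Rightarrow> real \<Rightarrow> (real \<Rightarrow> real) \<Rightarrow> (real^'n::{finite,linorder} \<Rightarrow> ennreal) \<Rightarrow> real^'n::{finite,linorder} \<Rightarrow> ennreal" where
  "kac_gain a b g f v = ennreal (a / real (card (pairs :: ('n\<times>'n) set))) * (\<Sum>p\<in>pairs. pair_gain (fst p) (snd p) f v)
     + ennreal (b / real CARD('n)) * (\<Sum>j\<in>UNIV. therm_gain g j f v)"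

definition kac_gain_dual :: "real \<Rightarrow> real \<Rightarrow> (real \<Rightarrow> real) \<Rightarrow> (real^'n::{finite,linorder} \<Rightarrow> ennreal) \<Rightarrow> real^'n::{finite,linorder} \<Rightarrow> ennreal" where
  "kac_gain_dual a b g h v = ennreal (a / real (card (pairs :: ('n\<times>'n) set))) * (\<Sum>p\<in>pairs. pair_gain_dual (fst p) (snd p) h v)
     + ennreal (b / real CARD('n)) * (\<Sum>j\<in>UNIV. therm_gain_dual g j h v)"

section \<open>Quadratic observables and the energy\<close>

definition zero_on :: "'n set \<Rightarrow> real^'n::finite \<Rightarrow> real^'n" where
  "zero_on S a = (\<chi> k. if k \<in> S then 0 else a $ k)"

lemma zero_on_nth [simp]: "zero_on S a $ k = (if k \<in> S then 0 else a $ k)"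
  by (simp add: zero_on_def)

text \<open>Splits a linear observable into the part untouched by a collision among the particles in
  \<open>S\<close> and the part that the angle average acts on.\<close>

lemma inner_zero_on: "a \<bullet> v = zero_on S a \<bullet> v + (\<Sum>k\<in>S. a $ k * v $ k)"
proof -
  have "a \<bullet> v = (\<Sum>k\<in>UNIV. zero_on S a $ k * v $ k + (if k \<in> S then a $ k * v $ k else 0))"
    unfolding inner_vec_def by (intro sum.cong) auto
  also have "\<dots> = zero_on S a \<bullet> v + (\<Sum>k\<in>S. a $ k * v $ k)"
    by (simp add: sum.distrib inner_vec_def sum.If_cases)
  finally show ?thesis .
qed

lemma inner_zero_on_cong: "(\<And>k. k \<notin> S \<Longrightarrow> v $ k = w $ k) \<Longrightarrow> zero_on S a \<bullet> v = zero_on S a \<bullet> w"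
  unfolding inner_vec_def by (intro sum.cong) auto

lemma nn_integral_angle_square0:
  "(\<integral>\<^sup>+\<theta>. ennreal ((B + A * cos \<theta> + D * sin \<theta>)\<^sup>2) \<partial>angle) = ennreal (B\<^sup>2 + (A\<^sup>2 + D\<^sup>2) / 2)"
  using nn_integral_angle_square[of 0 B A D] by simp

text \<open>The rotated part is \<open>A * cos \<theta> + D * sin \<theta>\<close>, its cross term
  with the untouched part averages out, and Lagrange's identity evaluates
  \<open>A\<^sup>2 + D\<^sup>2\<close>. Only the squares of the two coefficients remain, so their
  relative sign is forgotten.\<close>

lemma pair_gain_dual_square:
  fixes a v :: "real^'n::{finite,linorder}"
  assumes ij: "i \<noteq> j"
  shows "pair_gain_dual i j (\<lambda>v. ennreal ((c + a \<bullet> v)\<^sup>2)) v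
    = ennreal ((c + zero_on {i,j} a \<bullet> v)\<^sup>2 + ((a $ i)\<^sup>2 + (a $ j)\<^sup>2) * ((v $ i)\<^sup>2 + (v $ j)\<^sup>2) / 2)"
proof -
  let ?B = "c + zero_on {i,j} a \<bullet> v" and ?A = "a $ i * v $ i + a $ j * v $ j" and ?D = "a $ j * v $ i - a $ i * v $ j"
  have eq: "c + a \<bullet> pair_rot i j (-\<theta>) v = ?B + ?A * cos \<theta> + ?D * sin \<theta>" for \<theta>
  proof -
    have "zero_on {i,j} a \<bullet> pair_rot i j (-\<theta>) v = zero_on {i,j} a \<bullet> v"
      by (rule inner_zero_on_cong) (auto simp: pair_rot_def)
    then show ?thesis
      using ij by (subst inner_zero_on[of _ _ "{i,j}"]) (simp add: pair_rot_upd algebra_simps)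
  qed
  have sq: "?A\<^sup>2 + ?D\<^sup>2 = ((a $ i)\<^sup>2 + (a $ j)\<^sup>2) * ((v $ i)\<^sup>2 + (v $ j)\<^sup>2)"
    by (simp add: power2_eq_square algebra_simps)
  show ?thesis unfolding pair_gain_dual_def eq nn_integral_angle_square0 sq ..
qed

definition energy :: "real^'n::finite \<Rightarrow> real" where
  "energy v = (\<Sum>k\<in>UNIV. (v $ k)\<^sup>2)"

lemma energy_nonneg [simp]: "0 \<le> energy v"
  by (simp add: energy_def sum_nonneg)

lemma component_le_energy: "(v $ k)\<^sup>2 \<le> energy v"
  unfolding energy_def by (rule member_le_sum) auto

lemma measurable_energy [measurable]: "energy \<in> borel_measurable borel"
  unfolding energy_def by measurable

lemma energy_upd: "energy (upd v i x) = energy v - (v $ i)\<^sup>2 + x\<^sup>2"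
  unfolding energy_def by (subst (1 2) sum.remove[of _ i]) auto

lemma energy_pair_rot:
  assumes "i \<noteq> j" shows "energy (pair_rot i j \<theta> v) = energy v"
proof -
  have "(x * cos \<theta> + y * sin \<theta>)\<^sup>2 + (y * cos \<theta> - x * sin \<theta>)\<^sup>2 = x\<^sup>2 + y\<^sup>2" for x y
    using sin_cos_squared_add3[of \<theta>] by algebra
  from this[of "v $ i" "v $ j"] show ?thesis
    using assms by (simp add: pair_rot_upd energy_upd)
qed

text \<open>The rates are normalized to probabilities. The parameter \<open>ty\<close> carries the
  index type, which occurs in none of the other parameters.\<close>

locale thermostatted_kac =
  fixes a b :: real and g :: "real \<Rightarrow> real" and ty :: "'n::{finite,linorder} itself"
  assumes N: "CARD('n) \<ge> 2"
    and a: "0 \<le> a" and b: "0 < b" and ab: "a + b = 1"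
    and g_meas [measurable]: "g \<in> borel_measurable borel"
    and g_nonneg: "\<And>w. 0 \<le> g w"
    and g_int: "integrable lborel g" and g_mass: "(\<integral>w. g w \<partial>lborel) = 1"
    and g_second: "integrable lborel (\<lambda>w. w\<^sup>2 * g w)"
begin

abbreviation P :: "(real^'n::{finite,linorder} \<Rightarrow> ennreal) \<Rightarrow> real^'n::{finite,linorder} \<Rightarrow> ennreal" where
  "P \<equiv> kac_gain a b g"

abbreviation Ps :: "(real^'n::{finite,linorder} \<Rightarrow> ennreal) \<Rightarrow> real^'n::{finite,linorder} \<Rightarrow> ennreal" where
  "Ps \<equiv> kac_gain_dual a b g"

definition Kg :: real where "Kg = (\<integral>w. w\<^sup>2 * g w \<partial>lborel)"

definition npairs :: real where "npairs = real (card (pairs :: ('n\<times>'n) set))"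

lemma Kg_nonneg: "0 \<le> Kg"
  unfolding Kg_def using g_nonneg by (intro integral_nonneg_AE) auto

lemma npairs_pos: "0 < npairs"
  using N by (simp add: npairs_def card_pairs)

lemma N_pos: "0 < real CARD('n)"
  using N by simp

lemma g_nn_mass: "(\<integral>\<^sup>+w. ennreal (g w) \<partial>lborel) = 1"
  using g_int g_nonneg by (simp add: nn_integral_eq_integral g_mass)

lemma g_nn_second: "\<lbrakk>0 \<le> B; 0 \<le> D\<rbrakk> \<Longrightarrow> (\<integral>\<^sup>+w. ennreal (g w) * ennreal (B + D * w\<^sup>2) \<partial>lborel) = ennreal (B + D * Kg)"
  unfolding Kg_def by (rule nn_integral_second_moment[OF g_nonneg g_int g_second g_mass])

lemma weighted_average:
  assumes "\<And>p. p \<in> pairs \<Longrightarrow> 0 \<le> x p" "\<And>j. 0 \<le> y j"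
  shows "ennreal (a / npairs) * (\<Sum>p\<in>(pairs :: ('n\<times>'n) set). ennreal (x p)) + ennreal (b / real CARD('n)) * (\<Sum>j\<in>UNIV. ennreal (y (j::'n)))
    = ennreal (a / npairs * (\<Sum>p\<in>pairs. x p) + b / real CARD('n) * (\<Sum>j\<in>UNIV. y j))"
  using assms a b npairs_pos N_pos
  by (simp add: sum_ennreal sum_nonneg ennreal_plus[symmetric] del: ennreal_plus flip: ennreal_mult)

lemma weighted_average_const:
  "a / npairs * (\<Sum>p\<in>(pairs :: ('n\<times>'n) set). x) + b / real CARD('n) * (\<Sum>j\<in>(UNIV::'n set). x) = x"
proof -
  have "a / npairs * (\<Sum>p\<in>(pairs :: ('n\<times>'n) set). x) + b / real CARD('n) * (\<Sum>j\<in>(UNIV::'n set). x) = (a + b) * x"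
    using npairs_pos N_pos by (simp add: npairs_def[symmetric] algebra_simps)
  then show ?thesis by (simp add: ab)
qed

sublocale dual_operator lborel P Ps
proof
  fix f h :: "(real, 'n) vec \<Rightarrow> ennreal"
  show "P f \<in> borel_measurable lborel" if [measurable]: "f \<in> borel_measurable lborel"
    unfolding kac_gain_def using that by simp
  show "Ps h \<in> borel_measurable lborel" if "h \<in> borel_measurable lborel"
    unfolding kac_gain_dual_def using that by simp
  show "(\<integral>\<^sup>+v. h v * P f v \<partial>lborel) = (\<integral>\<^sup>+v. Ps h v * f v \<partial>lborel)"
    if "f \<in> borel_measurable lborel" "h \<in> borel_measurable lborel"
  proof -
    have [measurable]: "f \<in> borel_measurable borel" "h \<in> borel_measurable borel" using that by auto
    have "(\<integral>\<^sup>+v. h v * P f v \<partial>lborel)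
       = (\<integral>\<^sup>+v. ennreal (a / npairs) * (\<Sum>p\<in>pairs. h v * pair_gain (fst p) (snd p) f v)
         + ennreal (b / real CARD('n)) * (\<Sum>j\<in>UNIV. h v * therm_gain g j f v) \<partial>lborel)"
      by (intro nn_integral_cong) (simp add: kac_gain_def npairs_def distrib_left sum_distrib_left ac_simps)
    also have "\<dots> = ennreal (a / npairs) * (\<Sum>p\<in>pairs. \<integral>\<^sup>+v. pair_gain_dual (fst p) (snd p) h v * f v \<partial>lborel)
         + ennreal (b / real CARD('n)) * (\<Sum>j\<in>UNIV. \<integral>\<^sup>+v. therm_gain_dual g j h v * f v \<partial>lborel)"
      by (simp add: nn_integral_add nn_integral_cmult nn_integral_sum pair_gain_duality pairs_neq therm_gain_duality)
    also have "\<dots> = (\<integral>\<^sup>+v. ennreal (a / npairs) * (\<Sum>p\<in>pairs. pair_gain_dual (fst p) (snd p) h v * f v)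
         + ennreal (b / real CARD('n)) * (\<Sum>j\<in>UNIV. therm_gain_dual g j h v * f v) \<partial>lborel)"
      by (simp add: nn_integral_add nn_integral_cmult nn_integral_sum)
    also have "\<dots> = (\<integral>\<^sup>+v. Ps h v * f v \<partial>lborel)"
      by (intro nn_integral_cong) (simp add: kac_gain_dual_def npairs_def distrib_right mult.assoc flip: sum_distrib_right)
    finally show ?thesis .
  qed
  have "Ps (\<lambda>_. 1) v = 1" for v :: "(real, 'n) vec"
  proof -
    have "Ps (\<lambda>_. 1) v = ennreal (a / npairs) * (\<Sum>p\<in>(pairs :: ('n\<times>'n) set). ennreal 1) + ennreal (b / real CARD('n)) * (\<Sum>j\<in>(UNIV::'n set). ennreal 1)"
      by (simp add: kac_gain_dual_def npairs_def pair_gain_dual_def therm_gain_dual_def g_nn_mass)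
    also have "\<dots> = 1" by (subst weighted_average) (use weighted_average_const[of 1] in simp_all)
    finally show ?thesis .
  qed
  then show "Ps (\<lambda>_. 1) = (\<lambda>_. 1 :: ennreal)" by auto
qed

lemma therm_gain_dual_square:
  fixes \<alpha> v :: "real^'n::{finite,linorder}"
  shows "therm_gain_dual g j (\<lambda>v. ennreal ((c + \<alpha> \<bullet> v)\<^sup>2)) v
    = ennreal ((c + zero_on {j} \<alpha> \<bullet> v)\<^sup>2 + (\<alpha> $ j)\<^sup>2 * ((v $ j)\<^sup>2 + Kg) / 2)"
proof -
  let ?B = "c + zero_on {j} \<alpha> \<bullet> v"
  have eq: "c + \<alpha> \<bullet> upd v j (v $ j * cos \<theta> - w * sin \<theta>) = ?B + (\<alpha> $ j * v $ j) * cos \<theta> + (- \<alpha> $ j * w) * sin \<theta>" for \<theta> w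
  proof -
    have "zero_on {j} \<alpha> \<bullet> upd v j (v $ j * cos \<theta> - w * sin \<theta>) = zero_on {j} \<alpha> \<bullet> v"
      by (rule inner_zero_on_cong) auto
    then show ?thesis
      by (subst inner_zero_on[of _ _ "{j}"]) (simp add: algebra_simps)
  qed
  have "therm_gain_dual g j (\<lambda>v. ennreal ((c + \<alpha> \<bullet> v)\<^sup>2)) v
    = (\<integral>\<^sup>+w. ennreal (g w) * ennreal ((?B\<^sup>2 + (\<alpha> $ j)\<^sup>2 * (v $ j)\<^sup>2 / 2) + (\<alpha> $ j)\<^sup>2 / 2 * w\<^sup>2) \<partial>lborel)"
    unfolding therm_gain_dual_def eq nn_integral_angle_square0
    by (simp add: power_mult_distrib add_divide_distrib add.assoc)
  also have "\<dots> = ennreal ((?B\<^sup>2 + (\<alpha> $ j)\<^sup>2 * (v $ j)\<^sup>2 / 2) + (\<alpha> $ j)\<^sup>2 / 2 * Kg)"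
    by (rule g_nn_second) auto
  finally show ?thesis by (simp add: algebra_simps add_divide_distrib)
qed

text \<open>A closed system: each term is again the square of an affine function with fewer
  coefficients, or a combination of squared components and \<open>Kg\<close>.\<close>

lemma Ps_square:
  fixes \<alpha> v :: "real^'n::{finite,linorder}"
  shows "Ps (\<lambda>v. ennreal ((c + \<alpha> \<bullet> v)\<^sup>2)) v = ennreal (
     a / npairs * (\<Sum>p\<in>pairs. (c + zero_on {fst p, snd p} \<alpha> \<bullet> v)\<^sup>2
        + ((\<alpha> $ fst p)\<^sup>2 + (\<alpha> $ snd p)\<^sup>2) * ((v $ fst p)\<^sup>2 + (v $ snd p)\<^sup>2) / 2)
   + b / real CARD('n) * (\<Sum>j\<in>UNIV. (c + zero_on {j} \<alpha> \<bullet> v)\<^sup>2 + (\<alpha> $ j)\<^sup>2 * ((v $ j)\<^sup>2 + Kg) / 2))"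
  by (subst weighted_average[symmetric])
     (simp_all add: Kg_nonneg kac_gain_dual_def npairs_def therm_gain_dual_square pair_gain_dual_square pairs_neq)

text \<open>Pair collisions conserve energy. A collision of \<open>j\<close> with the thermostat
  replaces \<open>(v $ j)\<^sup>2\<close> on average by half the sum of itself and
  \<open>Kg\<close>; summed over \<open>j\<close> with probability \<open>b / N\<close> each, half
  of the energy is lost with weight \<open>b / N\<close>. The form
  \<open>\<alpha> * energy v + c\<close> is kept, so the step can be iterated.\<close>

lemma Ps_energy:
  fixes v :: "real^'n::{finite,linorder}"
  assumes "0 \<le> \<alpha>" "0 \<le> c"
  shows "Ps (\<lambda>v. ennreal (\<alpha> * energy v + c)) v
    = ennreal (\<alpha> * (1 - b / (2 * real CARD('n))) * energy v + (c + \<alpha> * b * Kg / 2))"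
proof -
  have p: "pair_gain_dual (fst p) (snd p) (\<lambda>v. ennreal (\<alpha> * energy v + c)) v = ennreal (\<alpha> * energy v + c)"
    if "p \<in> pairs" for p
    using pairs_neq[OF that] by (simp add: pair_gain_dual_def energy_pair_rot)
  have t: "therm_gain_dual g j (\<lambda>v. ennreal (\<alpha> * energy v + c)) v
     = ennreal (\<alpha> * energy v + c - \<alpha> * (v $ j)\<^sup>2 / 2 + \<alpha> * Kg / 2)" for j
  proof -
    let ?E = "\<alpha> * (energy v - (v $ j)\<^sup>2) + c"
    have E: "0 \<le> ?E" using assms component_le_energy[of v j] by simp
    \<comment> \<open>The factor \<open>\<alpha>\<close> enters the square as
      \<open>sqrt \<alpha>\<close>, while the energy of the untouched velocities and
      \<open>c\<close> form the nonnegative remainder \<open>?E\<close>.\<close>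
    have eq: "\<alpha> * energy (upd v j (v $ j * cos \<theta> - w * sin \<theta>)) + c
        = (0 + sqrt \<alpha> * v $ j * cos \<theta> + (- sqrt \<alpha> * w) * sin \<theta>)\<^sup>2 + ?E" for \<theta> w
    proof -
      have "0 + sqrt \<alpha> * v $ j * cos \<theta> + (- sqrt \<alpha> * w) * sin \<theta> = sqrt \<alpha> * (v $ j * cos \<theta> - w * sin \<theta>)"
        by (simp add: algebra_simps)
      then have "(0 + sqrt \<alpha> * v $ j * cos \<theta> + (- sqrt \<alpha> * w) * sin \<theta>)\<^sup>2 = \<alpha> * (v $ j * cos \<theta> - w * sin \<theta>)\<^sup>2"
        using assms by (simp only: power_mult_distrib) simp
      then show ?thesis by (simp only: energy_upd) (simp add: distrib_left right_diff_distrib)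
    qed
    have "therm_gain_dual g j (\<lambda>v. ennreal (\<alpha> * energy v + c)) v
      = (\<integral>\<^sup>+w. ennreal (g w) * ennreal ((\<alpha> * (v $ j)\<^sup>2 / 2 + ?E) + \<alpha> / 2 * w\<^sup>2) \<partial>lborel)"
      unfolding therm_gain_dual_def eq nn_integral_angle_square[OF E]
      using assms by (simp add: power_mult_distrib add_divide_distrib algebra_simps)
    also have "\<dots> = ennreal ((\<alpha> * (v $ j)\<^sup>2 / 2 + ?E) + \<alpha> / 2 * Kg)"
      using assms E by (intro g_nn_second) auto
    finally show ?thesis by (simp add: algebra_simps)
  qed
  have nn: "0 \<le> \<alpha> * energy v + c - \<alpha> * (v $ j)\<^sup>2 / 2 + \<alpha> * Kg / 2" for j
  proof -
    have "\<alpha> * (v $ j)\<^sup>2 \<le> \<alpha> * energy v" using assms component_le_energy[of v j] by (intro mult_left_mono)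
    moreover have "0 \<le> \<alpha> * (v $ j)\<^sup>2" "0 \<le> \<alpha> * Kg" using assms Kg_nonneg by auto
    ultimately show ?thesis using assms by linarith
  qed
  have "Ps (\<lambda>v. ennreal (\<alpha> * energy v + c)) v
    = ennreal (a / npairs * (\<Sum>p\<in>(pairs::('n\<times>'n) set). \<alpha> * energy v + c)
      + b / real CARD('n) * (\<Sum>j\<in>UNIV. \<alpha> * energy v + c - \<alpha> * (v $ j)\<^sup>2 / 2 + \<alpha> * Kg / 2))"
    using assms nn by (subst weighted_average[symmetric]) (simp_all add: kac_gain_dual_def npairs_def p t del: ennreal_plus sum_constant)
  also have "(\<Sum>j\<in>UNIV. \<alpha> * energy v + c - \<alpha> * (v $ j)\<^sup>2 / 2 + \<alpha> * Kg / 2)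
     = (\<Sum>j\<in>(UNIV::'n set). \<alpha> * energy v + c) - \<alpha> / 2 * energy v + real CARD('n) * (\<alpha> * Kg / 2)"
    by (simp add: sum.distrib sum_subtractf energy_def sum_distrib_left)
  also have "a / npairs * (\<Sum>p\<in>(pairs::('n\<times>'n) set). \<alpha> * energy v + c)
      + b / real CARD('n) * ((\<Sum>j\<in>(UNIV::'n set). \<alpha> * energy v + c) - \<alpha> / 2 * energy v + real CARD('n) * (\<alpha> * Kg / 2))
     = (a / npairs * (\<Sum>p\<in>(pairs::('n\<times>'n) set). \<alpha> * energy v + c)
       + b / real CARD('n) * (\<Sum>j\<in>(UNIV::'n set). \<alpha> * energy v + c))
       - b / real CARD('n) * (\<alpha> / 2 * energy v) + b * \<alpha> * Kg / 2"
    using N_pos by (simp only: ring_distribs) simp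
  also have "\<dots> = \<alpha> * (1 - b / (2 * real CARD('n))) * energy v + (c + \<alpha> * b * Kg / 2)"
    unfolding weighted_average_const by (simp add: algebra_simps)
  finally show ?thesis .
qed

end

section \<open>Minorization and the invariant density\<close>

definition splice :: "'n set \<Rightarrow> ('n \<Rightarrow> real) \<Rightarrow> real^'n::finite \<Rightarrow> real^'n" where
  "splice S z v = (\<chi> k. if k \<in> S then z k else v $ k)"

lemma splice_nth [simp]: "splice S z v $ k = (if k \<in> S then z k else v $ k)"
  by (simp add: splice_def)

lemma measurable_splice [measurable]:
  fixes v :: "real^'n::finite"
  shows "(\<lambda>z. splice S z v) \<in> borel_measurable (Pi\<^sub>M S (\<lambda>_. lborel))"
proof -
  have "(\<lambda>z. if k \<in> S then z k else v $ k) \<in> borel_measurable (Pi\<^sub>M S (\<lambda>_. lborel))" for k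
    by (cases "k \<in> S") auto
  then show ?thesis unfolding splice_def by (rule borel_measurable_vec_lambda)
qed

context thermostatted_kac
begin

text \<open>The annuli \<open>1 / (n + 1) \<le> \<bar>w\<bar> \<le> n + 1\<close> exhaust the line
  except for the null set \<open>{0}\<close>, so a density of mass one must charge one of
  them.\<close>

lemma g_mass_annulus:
  obtains \<delta> m p where "0 < \<delta>" "0 < m" "0 < p"
    "(\<integral>\<^sup>+w. ennreal (g w) * indicator {w. \<delta> \<le> \<bar>w\<bar> \<and> \<bar>w\<bar> \<le> m} w \<partial>lborel) = ennreal p"
proof -
  let ?A = "\<lambda>n::nat. {w::real. 1 / real (Suc n) \<le> \<bar>w\<bar> \<and> \<bar>w\<bar> \<le> real (Suc n)}"
  let ?I = "\<lambda>n. \<integral>\<^sup>+w. ennreal (g w) * indicator (?A n) w \<partial>lborel"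
  have "\<exists>n. ?I n \<noteq> 0"
  proof (rule ccontr)
    assume "\<not> ?thesis"
    then have "AE w in lborel. ennreal (g w) * indicator (?A n) w = 0" for n
      by (subst nn_integral_0_iff_AE[symmetric]) auto
    then have "AE w in lborel. \<forall>n. ennreal (g w) * indicator (?A n) w = 0"
      by (subst AE_all_countable) auto
    then have "AE w in lborel. ennreal (g w) = 0"
      using AE_lborel_singleton[of "0::real"]
    proof eventually_elim
      case (elim w)
      obtain n1 where n1: "1 / \<bar>w\<bar> \<le> real n1" using real_arch_simple by blast
      obtain n2 where n2: "\<bar>w\<bar> \<le> real n2" using real_arch_simple by blast
      have "1 / \<bar>w\<bar> \<le> real (Suc (max n1 n2))" using n1 by (simp add: of_nat_max)
      then have "1 / real (Suc (max n1 n2)) \<le> \<bar>w\<bar>" using elim(2) by (simp add: field_simps)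
      then have "w \<in> ?A (max n1 n2)" using n2 by (simp add: of_nat_max)
      with elim(1)[rule_format, of "max n1 n2"] show ?case by (simp add: indicator_def)
    qed
    then have "(\<integral>\<^sup>+w. ennreal (g w) \<partial>lborel) = 0" by (subst nn_integral_0_iff_AE) auto
    then show False by (simp add: g_nn_mass)
  qed
  then obtain n where n: "?I n \<noteq> 0" by blast
  have "?I n \<le> (\<integral>\<^sup>+w. ennreal (g w) \<partial>lborel)" by (intro nn_integral_mono) (auto simp: indicator_def)
  then have "?I n < \<infinity>" by (simp add: g_nn_mass order_le_less_trans)
  then obtain p where p: "?I n = ennreal p" "0 \<le> p" by (cases "?I n") auto
  with n have "0 < p" by (cases "p = 0") auto
  then show ?thesis using that[of "1 / real (Suc n)" "real (Suc n)" p] p by simp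
qed

text \<open>Keeps only the event that particle \<open>j\<close> meets the thermostat.\<close>

lemma Ps_ge: "ennreal (b / real CARD('n)) * therm_gain_dual g j h v \<le> Ps h (v :: (real, 'n) vec)"
proof -
  have "therm_gain_dual g j h v \<le> (\<Sum>j\<in>UNIV. therm_gain_dual g j h v)"
    by (rule member_le_sum) auto
  then have "ennreal (b / real CARD('n)) * therm_gain_dual g j h v \<le> ennreal (b / real CARD('n)) * (\<Sum>j\<in>UNIV. therm_gain_dual g j h v)"
    by (rule mult_left_mono) simp
  then show ?thesis unfolding kac_gain_dual_def by (rule add_increasing[OF zero_le])
qed

text \<open>Refresh the coordinates in \<open>S\<close> one after the other; each refreshed velocity is spread over
  \<open>[-\<delta>, \<delta>]\<close> with density bounded below.\<close>

lemma Ps_funpow_ge: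
  fixes h :: "real^'n::{finite,linorder} \<Rightarrow> ennreal"
  assumes \<delta>: "0 < \<delta>" and m: "0 < m" and R: "0 \<le> R"
    and p: "(\<integral>\<^sup>+w. ennreal (g w) * indicator {w. \<delta> \<le> \<bar>w\<bar> \<and> \<bar>w\<bar> \<le> m} w \<partial>lborel) = ennreal p"
    and \<kappa>: "\<kappa> = ennreal (b / real CARD('n)) * (ennreal (1 / (2*pi*(R + m))) * ennreal p)"
    and v: "\<And>k. \<bar>v $ k\<bar> \<le> R" and h: "h \<in> borel_measurable borel"
  shows "\<kappa> ^ card S * (\<integral>\<^sup>+z. h (splice S z v) * (\<Prod>k\<in>S. indicator {-\<delta>..\<delta>} (z k)) \<partial>Pi\<^sub>M S (\<lambda>_. lborel)) \<le> (Ps ^^ card S) h v"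
  using finite[of S] h
proof (induction S arbitrary: h rule: finite_induct)
  case empty
  have "splice {} z v = v" for z by (simp add: vec_eq_iff)
  then show ?case by (simp add: PiM_empty nn_integral_count_space_finite)
next
  case (insert j S)
  interpret product_sigma_finite "\<lambda>_::'n. lborel :: real measure" by standard
  note [measurable] = insert.prems
  let ?i = "indicator {-\<delta>..\<delta>} :: real \<Rightarrow> ennreal"
  \<comment> \<open>Needed at \<open>u = splice S z v\<close>: since \<open>j\<close> is not in
    \<open>S\<close>, its coordinate there is still \<open>v $ j\<close>, so the original bound
    \<open>R\<close> suffices and does not grow with the number of refreshed coordinates.\<close>
  have one: "\<kappa> * (\<integral>\<^sup>+y. h (upd u j y) * ?i y \<partial>lborel) \<le> Ps h u" if "\<bar>u $ j\<bar> \<le> R" for u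
  proof -
    have "ennreal (1 / (2*pi*(R + m))) * ennreal p * (\<integral>\<^sup>+y. h (upd u j y) * ?i y \<partial>lborel) \<le> therm_gain_dual g j h u"
      using therm_gain_dual_ge[OF insert.prems g_meas \<delta> R that, of m] m by (simp add: p)
    then have "ennreal (b / real CARD('n)) * (ennreal (1 / (2*pi*(R + m))) * ennreal p * (\<integral>\<^sup>+y. h (upd u j y) * ?i y \<partial>lborel))
      \<le> ennreal (b / real CARD('n)) * therm_gain_dual g j h u" by (rule mult_left_mono) simp
    also have "\<dots> \<le> Ps h u" by (rule Ps_ge)
    finally show ?thesis by (simp add: \<kappa> mult.assoc)
  qed
  have s: "splice (insert j S) (z(j := y)) v = upd (splice S z v) j y" for z y
    using insert.hyps by (auto simp: vec_eq_iff)
  have pr: "(\<Prod>k\<in>insert j S. ?i ((z(j := y)) k)) = ?i y * (\<Prod>k\<in>S. ?i (z k))" for z y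
  proof -
    have "(\<Prod>k\<in>S. ?i ((z(j := y)) k)) = (\<Prod>k\<in>S. ?i (z k))"
      using insert.hyps by (intro prod.cong) auto
    then show ?thesis by (subst prod.insert[OF insert.hyps]) simp
  qed
  have "(\<integral>\<^sup>+z. h (splice (insert j S) z v) * (\<Prod>k\<in>insert j S. ?i (z k)) \<partial>Pi\<^sub>M (insert j S) (\<lambda>_. lborel))
    = (\<integral>\<^sup>+z. (\<integral>\<^sup>+y. h (upd (splice S z v) j y) * ?i y * (\<Prod>k\<in>S. ?i (z k)) \<partial>lborel) \<partial>Pi\<^sub>M S (\<lambda>_. lborel))"
    using insert.hyps by (subst product_nn_integral_insert) (simp_all only: s pr mult.assoc, measurable)
  also have "\<dots> = (\<integral>\<^sup>+z. (\<integral>\<^sup>+y. h (upd (splice S z v) j y) * ?i y \<partial>lborel) * (\<Prod>k\<in>S. ?i (z k)) \<partial>Pi\<^sub>M S (\<lambda>_. lborel))"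
    by (simp add: nn_integral_multc)
  finally have "\<kappa> ^ card (insert j S) * (\<integral>\<^sup>+z. h (splice (insert j S) z v) * (\<Prod>k\<in>insert j S. ?i (z k)) \<partial>Pi\<^sub>M (insert j S) (\<lambda>_. lborel))
    = \<kappa> ^ card S * (\<kappa> * (\<integral>\<^sup>+z. (\<integral>\<^sup>+y. h (upd (splice S z v) j y) * ?i y \<partial>lborel) * (\<Prod>k\<in>S. ?i (z k)) \<partial>Pi\<^sub>M S (\<lambda>_. lborel)))"
    using insert.hyps by (simp add: ac_simps)
  also have "\<dots> = \<kappa> ^ card S * (\<integral>\<^sup>+z. \<kappa> * ((\<integral>\<^sup>+y. h (upd (splice S z v) j y) * ?i y \<partial>lborel) * (\<Prod>k\<in>S. ?i (z k))) \<partial>Pi\<^sub>M S (\<lambda>_. lborel))"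
    by (subst nn_integral_cmult) auto
  also have "\<dots> \<le> \<kappa> ^ card S * (\<integral>\<^sup>+z. Ps h (splice S z v) * (\<Prod>k\<in>S. ?i (z k)) \<partial>Pi\<^sub>M S (\<lambda>_. lborel))"
    using insert.hyps v by (intro mult_left_mono nn_integral_mono) (auto simp flip: mult.assoc intro!: mult_right_mono one)
  also have "\<dots> \<le> (Ps ^^ card S) (Ps h) v"
    using Ps_measurable[of h] by (intro insert.IH) simp
  also have "\<dots> = (Ps ^^ card (insert j S)) h v"
    using insert.hyps by (simp add: funpow_swap1)
  finally show ?case .
qed

lemma Ps_funpow_energy:
  "\<exists>c\<ge>0. (Ps ^^ n) (\<lambda>v. ennreal (energy v)) = (\<lambda>v. ennreal ((1 - b / (2 * real CARD('n))) ^ n * energy v + c))"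
proof (induction n)
  case 0
  show ?case by (rule exI[of _ 0]) simp
next
  case (Suc n)
  let ?\<gamma> = "1 - b / (2 * real CARD('n))"
  have \<gamma>: "0 \<le> ?\<gamma>" using N a ab b by (simp add: field_simps)
  from Suc obtain c where c: "0 \<le> c" "(Ps ^^ n) (\<lambda>v. ennreal (energy v)) = (\<lambda>v. ennreal (?\<gamma> ^ n * energy v + c))" by blast
  have "(Ps ^^ Suc n) (\<lambda>v. ennreal (energy v)) v = ennreal (?\<gamma> ^ Suc n * energy v + (c + ?\<gamma> ^ n * b * Kg / 2))" for v
  proof -
    have "(Ps ^^ Suc n) (\<lambda>v. ennreal (energy v)) v = Ps (\<lambda>v. ennreal (?\<gamma> ^ n * energy v + c)) v"
      by (simp only: funpow.simps(2) o_apply c(2))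
    also have "\<dots> = ennreal (?\<gamma> ^ n * ?\<gamma> * energy v + (c + ?\<gamma> ^ n * b * Kg / 2))"
      by (rule Ps_energy) (use \<gamma> c in auto)
    finally show ?thesis by (simp only: power_Suc2)
  qed
  then have "(Ps ^^ Suc n) (\<lambda>v. ennreal (energy v)) = (\<lambda>v. ennreal (?\<gamma> ^ Suc n * energy v + (c + ?\<gamma> ^ n * b * Kg / 2)))"
    by blast
  moreover have "0 \<le> c + ?\<gamma> ^ n * b * Kg / 2" using c \<gamma> b Kg_nonneg by simp
  ultimately show ?case by blast
qed

lemma invariant_density:
  "\<exists>f :: real^'n::{finite,linorder} \<Rightarrow> ennreal. f \<in> borel_measurable borel \<and> (\<integral>\<^sup>+v. f v \<partial>lborel) = 1 \<and> (AE v in lborel. P f v = f v)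
     \<and> (\<integral>\<^sup>+v. ennreal (energy v) * f v \<partial>lborel) < \<infinity>
     \<and> (\<forall>f'. f' \<in> borel_measurable borel \<longrightarrow> (\<integral>\<^sup>+v. f' v \<partial>lborel) = 1 \<longrightarrow> (AE v in lborel. P f' v = f' v) \<longrightarrow> (AE v in lborel. f' v = f v))"
proof -
  obtain \<delta> m p where \<delta>: "0 < \<delta>" and m: "0 < m" and p0: "0 < p"
    and p: "(\<integral>\<^sup>+w. ennreal (g w) * indicator {w. \<delta> \<le> \<bar>w\<bar> \<and> \<bar>w\<bar> \<le> m} w \<partial>lborel) = ennreal p"
    by (rule g_mass_annulus)
  define n where "n = CARD('n)"
  have n: "n = card (UNIV :: 'n set)" "n > 0" using N by (auto simp: n_def)
  interpret K: dual_operator lborel "P ^^ n" "Ps ^^ n" by (rule dual_operator_funpow)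
  define U :: "(real, 'n) vec set" where "U = cbox (\<chi> k. -\<delta>) (\<chi> k. \<delta>)"
  have U: "v \<in> U \<longleftrightarrow> (\<forall>k. v $ k \<in> {-\<delta>..\<delta>})" for v by (auto simp: U_def mem_box_cart)
  have [measurable]: "U \<in> sets borel" by (simp add: U_def)
  have volU: "emeasure lborel U > 0" "emeasure lborel U < \<infinity>"
  proof -
    show "emeasure lborel U < \<infinity>" unfolding U_def by (rule emeasure_lborel_cbox_finite)
    have "(\<Prod>x\<in>Basis. ((\<chi> k. \<delta>) - (\<chi> k. - \<delta>) :: (real, 'n) vec) \<bullet> x) > 0"
      by (rule prod_pos) (use \<delta> in \<open>auto simp: Basis_vec_def inner_axis\<close>)
    moreover have "\<forall>x\<in>Basis. (\<chi> k. - \<delta> :: (real, 'n) vec) \<bullet> x \<le> (\<chi> k. \<delta>) \<bullet> x"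
      using \<delta> by (auto simp: Basis_vec_def inner_axis)
    ultimately show "emeasure lborel U > 0"
      unfolding U_def by (simp add: emeasure_lborel_cbox_eq)
  qed
  have ind: "indicator U v = (\<Prod>k\<in>UNIV. indicator {-\<delta>..\<delta>} (v $ k) :: ennreal)" for v
    by (auto simp: indicator_def U prod_eq_1_iff intro!: prod.neutral split: if_splits) 
  have minor: "\<exists>\<epsilon>>0. \<forall>h v. h \<in> borel_measurable lborel \<longrightarrow> v \<in> space lborel \<longrightarrow> energy v \<le> r \<longrightarrow>
      ennreal \<epsilon> * (\<integral>\<^sup>+y. h y * indicator U y \<partial>lborel) \<le> (Ps ^^ n) h v" for r
  proof -
    \<comment> \<open>The added 1 makes \<open>R\<close> positive and ensures
      \<open>r \<le> R\<^sup>2\<close>, so that an energy bound \<open>r\<close> bounds every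
      component by \<open>R\<close>.\<close>
    define R where "R = 1 + \<bar>r\<bar>"
    define e where "e = b / real CARD('n) * (1 / (2*pi*(R + m)) * p)"
    have e: "e > 0" using b p0 m N_pos by (auto simp: e_def R_def intro!: mult_pos_pos divide_pos_pos)
    have \<kappa>: "ennreal e = ennreal (b / real CARD('n)) * (ennreal (1 / (2*pi*(R + m))) * ennreal p)"
      using b p0 m by (simp add: e_def R_def flip: ennreal_mult)
    show ?thesis
    proof (intro exI[of _ "e ^ n"] conjI allI impI)
      show "0 < e ^ n" using e by simp
      fix h :: "(real, 'n) vec \<Rightarrow> ennreal" and v :: "(real, 'n) vec"
      assume h: "h \<in> borel_measurable lborel" and v: "energy v \<le> r"
      have [measurable]: "h \<in> borel_measurable borel" using h by simp
      have vR: "\<bar>v $ k\<bar> \<le> R" for k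
      proof (rule power2_le_imp_le)
        have "\<bar>v $ k\<bar>\<^sup>2 \<le> r" using component_le_energy[of v k] v by simp
        also have "\<dots> \<le> R\<^sup>2" by (simp add: R_def power2_eq_square algebra_simps add_increasing)
        finally show "\<bar>v $ k\<bar>\<^sup>2 \<le> R\<^sup>2" .
      qed (simp add: R_def)
      have "(\<integral>\<^sup>+y. h y * indicator U y \<partial>lborel) = (\<integral>\<^sup>+z. h (splice UNIV z v) * (\<Prod>k\<in>UNIV. indicator {-\<delta>..\<delta>} (z k)) \<partial>Pi\<^sub>M UNIV (\<lambda>_. lborel))"
        by (subst nn_integral_lborel_vec) (simp_all add: ind splice_def)
      then show "ennreal (e ^ n) * (\<integral>\<^sup>+y. h y * indicator U y \<partial>lborel) \<le> (Ps ^^ n) h v"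
        using Ps_funpow_ge[OF \<delta> m _ p \<kappa> vR, of h UNIV] e
        by (simp add: n_def R_def ennreal_power)
    qed
  qed
  define \<gamma> where "\<gamma> = (1 - b / (2 * real CARD('n))) ^ n"
  have "0 \<le> 1 - b / (2 * real CARD('n))" "1 - b / (2 * real CARD('n)) < 1"
    using N a ab b by (auto simp: field_simps)
  then have \<gamma>: "0 \<le> \<gamma>" "\<gamma> < 1"
    using power_strict_mono[of "1 - b / (2 * real CARD('n))" 1 n] n by (auto simp: \<gamma>_def)
  obtain c where c: "0 \<le> c" "(Ps ^^ n) (\<lambda>v. ennreal (energy v)) = (\<lambda>v. ennreal (\<gamma> * energy v + c))"
    using Ps_funpow_energy[of n] by (auto simp: \<gamma>_def)
  have UE: "(\<integral>\<^sup>+v. ennreal (energy v) * indicator U v \<partial>lborel) < \<infinity>"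
  proof -
    have "energy v \<le> real CARD('n) * \<delta>\<^sup>2" if "v \<in> U" for v
    proof -
      have "energy v \<le> (\<Sum>k\<in>(UNIV::'n set). \<delta>\<^sup>2)"
        unfolding energy_def using that \<delta> by (intro sum_mono) (auto simp: U abs_le_iff minus_le_iff intro!: power2_le_iff_abs_le[THEN iffD2])
      then show ?thesis by simp
    qed
    then have "(\<integral>\<^sup>+v. ennreal (energy v) * indicator U v \<partial>lborel) \<le> (\<integral>\<^sup>+v. ennreal (real CARD('n) * \<delta>\<^sup>2) * indicator U v \<partial>lborel)"
      by (intro nn_integral_mono) (auto simp: indicator_def intro!: ennreal_leI)
    also have "\<dots> < \<infinity>" using volU by (simp add: nn_integral_cmult ennreal_mult_less_top)
    finally show ?thesis .
  qed
  \<comment> \<open>The constant \<open>c\<close> may be zero, while \<open>invariant_exists\<close>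
    asks for a positive one; hence \<open>c + 1\<close>.\<close>
  have drift: "(Ps ^^ n) (\<lambda>v. ennreal (energy v)) v \<le> ennreal (\<gamma> * energy v + (c + 1))" for v
    unfolding c by (rule ennreal_leI) simp
  have "\<exists>f :: (real, 'n) vec \<Rightarrow> ennreal. f \<in> borel_measurable lborel \<and> (\<integral>\<^sup>+v. f v \<partial>lborel) = 1
    \<and> (AE v in lborel. (P ^^ n) f v = f v) \<and> (\<integral>\<^sup>+v. ennreal (energy v) * f v \<partial>lborel) < \<infinity>"
    by (rule K.invariant_exists[of energy U \<gamma> "c + 1", OF _ _ _ volU UE minor \<gamma> _ drift]) (use c in auto)
  then obtain f :: "(real, 'n) vec \<Rightarrow> ennreal" where f: "f \<in> borel_measurable lborel" "(\<integral>\<^sup>+v. f v \<partial>lborel) = 1"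
    "AE v in lborel. (P ^^ n) f v = f v" "(\<integral>\<^sup>+v. ennreal (energy v) * f v \<partial>lborel) < \<infinity>" by blast
  have unique: "AE v in lborel. f' v = f v"
    if "f' \<in> borel_measurable lborel" "(\<integral>\<^sup>+v. f' v \<partial>lborel) = 1" "AE v in lborel. (P ^^ n) f' v = f' v" for f'
    by (rule K.invariant_unique[of energy U, OF _ _ volU(1) minor]) (use that f in auto)
  \<comment> \<open>\<open>P\<close> commutes with its iterates, so \<open>P f\<close> is another
    density invariant under \<open>P ^^ n\<close>; uniqueness for the iterate identifies it with
    \<open>f\<close>.\<close>
  have "AE v in lborel. P f v = f v"
  proof (rule unique)
    show "P f \<in> borel_measurable lborel" using f by simp
    show "(\<integral>\<^sup>+v. P f v \<partial>lborel) = 1" using f by (simp add: mass_P)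
    have "AE v in lborel. P ((P ^^ n) f) v = P f v"
      by (rule P_cong_AE) (use f in auto)
    then show "AE v in lborel. (P ^^ n) (P f) v = P f v" by (simp add: funpow_swap1)
  qed
  moreover have "AE v in lborel. f' v = f v"
    if "f' \<in> borel_measurable borel" "(\<integral>\<^sup>+v. f' v \<partial>lborel) = 1" "AE v in lborel. P f' v = f' v" for f'
    by (rule unique) (use that invariant_funpow_AE[of f' n] in auto)
  ultimately show ?thesis using f by auto
qed

end

section \<open>Moments of a stationary measure\<close>

lemma energy_eq_inner: "energy v = v \<bullet> v"
  by (simp add: energy_def inner_vec_def power2_eq_square)

text \<open>Weak form of stationarity for the law with density F. Working with a measure lets
  moments be plain expectations, and finite energy makes all those of order at most two
  integrable.\<close>

locale stationary_measure = thermostatted_kac a b g ty + finite_measure M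
  for a b g and ty :: "'n::{finite,linorder} itself" and M :: "(real, 'n) vec measure" +
  assumes sets_M [simp, measurable_cong]: "sets M = sets borel"
    and measure_M [simp]: "measure M UNIV = 1"
    and stationary: "\<And>h. h \<in> borel_measurable borel \<Longrightarrow> (\<integral>\<^sup>+v. h v \<partial>M) = (\<integral>\<^sup>+v. Ps h v \<partial>M)"
    and energy_integrable: "integrable M energy"
begin

lemma space_M [simp]: "space M = UNIV"
  using sets_eq_imp_space_eq[OF sets_M] by simp

text \<open>First and mixed second moments are multiples of differences of two values of this
  function, and each \<open>D k\<close> is the value at a unit vector with
  \<open>c = 0\<close>.\<close>

definition \<Phi> :: "(real, 'n) vec \<Rightarrow> real \<Rightarrow> real" where
  "\<Phi> \<alpha> c = (\<integral>v. (c + \<alpha> \<bullet> v)\<^sup>2 \<partial>M)"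

definition D :: "'n \<Rightarrow> real" where "D k = (\<integral>v. (v $ k)\<^sup>2 \<partial>M)"

lemma integrable_square: "integrable M (\<lambda>v. (c + \<alpha> \<bullet> v)\<^sup>2)"
proof (rule Bochner_Integration.integrable_bound)
  show "integrable M (\<lambda>v. 2 * c\<^sup>2 + 2 * (\<alpha> \<bullet> \<alpha>) * energy v)"
    using energy_integrable by simp
  have "(c + \<alpha> \<bullet> v)\<^sup>2 \<le> 2 * c\<^sup>2 + 2 * (\<alpha> \<bullet> \<alpha>) * energy v" for v :: "(real, 'n) vec"
  proof -
    have "0 \<le> (c - \<alpha> \<bullet> v)\<^sup>2" by simp
    then have "(c + \<alpha> \<bullet> v)\<^sup>2 \<le> 2 * c\<^sup>2 + 2 * (\<alpha> \<bullet> v)\<^sup>2" by (simp add: power2_eq_square algebra_simps)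
    with Cauchy_Schwarz_ineq[of \<alpha> v] show ?thesis by (simp add: energy_eq_inner)
  qed
  then show "AE v in M. norm ((c + \<alpha> \<bullet> v)\<^sup>2) \<le> norm (2 * c\<^sup>2 + 2 * (\<alpha> \<bullet> \<alpha>) * energy v)"
    by (auto intro: order_trans[OF _ abs_ge_self])
qed measurable

lemma integrable_component_sq: "integrable M (\<lambda>v. (v $ k)\<^sup>2)"
  using integrable_square[of 0 "axis k 1"] by (simp add: inner_axis')

lemma integrable_component: "integrable M (\<lambda>v. v $ k)"
proof -
  have "integrable M (\<lambda>v. ((1 + axis k 1 \<bullet> v)\<^sup>2 - (- 1 + axis k 1 \<bullet> v)\<^sup>2) / 4)"
    by (intro Bochner_Integration.integrable_diff integrable_divide integrable_square)
  then show ?thesis by (simp add: inner_axis' power2_eq_square algebra_simps)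
qed

lemma integrable_component_prod: "integrable M (\<lambda>v. v $ k * v $ l)"
proof -
  have "integrable M (\<lambda>v. ((0 + (axis k 1 + axis l 1) \<bullet> v)\<^sup>2 - (0 + (axis k 1 - axis l 1) \<bullet> v)\<^sup>2) / 4)"
    by (intro Bochner_Integration.integrable_diff integrable_divide integrable_square)
  then show ?thesis by (simp add: inner_axis' inner_add_left inner_diff_left power2_eq_square algebra_simps)
qed

text \<open>Stationarity tested on the square of an affine function. Both sides are finite and
  nonnegative, so the identity descends from \<open>ennreal\<close> to the reals.\<close>

lemma \<Phi>_eq:
  "\<Phi> \<alpha> c = a / npairs * (\<Sum>p\<in>pairs. \<Phi> (zero_on {fst p, snd p} \<alpha>) c + ((\<alpha> $ fst p)\<^sup>2 + (\<alpha> $ snd p)\<^sup>2) * (D (fst p) + D (snd p)) / 2)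
    + b / real CARD('n) * (\<Sum>j\<in>UNIV. \<Phi> (zero_on {j} \<alpha>) c + (\<alpha> $ j)\<^sup>2 * (D j + Kg) / 2)"
  (is "_ = ?R")
proof -
  let ?q = "\<lambda>v :: (real, 'n) vec. a / npairs * (\<Sum>p\<in>pairs. (c + zero_on {fst p, snd p} \<alpha> \<bullet> v)\<^sup>2
        + ((\<alpha> $ fst p)\<^sup>2 + (\<alpha> $ snd p)\<^sup>2) * ((v $ fst p)\<^sup>2 + (v $ snd p)\<^sup>2) / 2)
   + b / real CARD('n) * (\<Sum>j\<in>UNIV. (c + zero_on {j} \<alpha> \<bullet> v)\<^sup>2 + (\<alpha> $ j)\<^sup>2 * ((v $ j)\<^sup>2 + Kg) / 2)"
  note int = integrable_square integrable_component_sq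
  have qi: "integrable M ?q" using int by auto
  have q: "(\<integral>v. ?q v \<partial>M) = ?R"
    using int by (simp add: \<Phi>_def D_def)
  have q0: "0 \<le> ?q v" for v
    using a b npairs_pos N_pos Kg_nonneg
    by (intro add_nonneg_nonneg mult_nonneg_nonneg sum_nonneg divide_nonneg_nonneg) auto
  have "ennreal (\<Phi> \<alpha> c) = (\<integral>\<^sup>+v. ennreal ((c + \<alpha> \<bullet> v)\<^sup>2) \<partial>M)"
    unfolding \<Phi>_def using int by (intro nn_integral_eq_integral[symmetric]) auto
  also have "\<dots> = (\<integral>\<^sup>+v. ennreal (?q v) \<partial>M)"
    by (subst stationary) (measurable, rule nn_integral_cong, rule Ps_square)
  also have "\<dots> = ennreal ?R"
    unfolding q[symmetric] using qi q0 by (intro nn_integral_eq_integral) auto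
  finally have *: "ennreal (\<Phi> \<alpha> c) = ennreal ?R" .
  have "0 \<le> \<Phi> \<alpha> c" unfolding \<Phi>_def by (rule integral_nonneg_AE) simp
  moreover have "0 \<le> ?R" unfolding q[symmetric] using q0 by (intro integral_nonneg_AE) auto
  ultimately show ?thesis using * by (simp only: ennreal_inj)
qed

text \<open>The diagonal terms \<open>D\<close> cancel in the difference; what remains is either kept or, averaged over
  the angle, killed by a collision, and collisions of \<open>t\<close> with the thermostat kill it.\<close>

lemma polarized_zero:
  assumes sq: "\<And>k. (\<alpha> $ k)\<^sup>2 = (\<beta> $ k)\<^sup>2" and T: "t \<in> T"
    and zero_on: "\<And>S. \<Phi> (zero_on S \<alpha>) c - \<Phi> (zero_on S \<beta>) d = (if S \<inter> T = {} then \<Delta> else 0)"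
  shows "\<Delta> = 0"
proof -
  have "zero_on {} x = x" for x :: "(real, 'n) vec" by (simp add: vec_eq_iff)
  then have "\<Delta> = \<Phi> \<alpha> c - \<Phi> \<beta> d" using zero_on[of "{}"] by simp
  also have "\<dots> = a / npairs * (\<Sum>p\<in>pairs. \<Phi> (zero_on {fst p, snd p} \<alpha>) c - \<Phi> (zero_on {fst p, snd p} \<beta>) d)
    + b / real CARD('n) * (\<Sum>j\<in>UNIV. \<Phi> (zero_on {j} \<alpha>) c - \<Phi> (zero_on {j} \<beta>) d)"
    by (subst (1 2) \<Phi>_eq) (simp add: sq sum.distrib sum_subtractf algebra_simps)
  finally have \<Delta>: "\<Delta> = a / npairs * (\<Sum>p\<in>(pairs :: ('n\<times>'n) set). if {fst p, snd p} \<inter> T = {} then \<Delta> else 0)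
    + b / real CARD('n) * (\<Sum>j\<in>(UNIV :: 'n set). if {j} \<inter> T = {} then \<Delta> else 0)"
    unfolding zero_on .
  have "\<bar>\<Delta>\<bar> \<le> \<bar>a / npairs * (\<Sum>p\<in>(pairs :: ('n\<times>'n) set). if {fst p, snd p} \<inter> T = {} then \<Delta> else 0)\<bar>
    + \<bar>b / real CARD('n) * (\<Sum>j\<in>(UNIV :: 'n set). if {j} \<inter> T = {} then \<Delta> else 0)\<bar>"
    by (subst \<Delta>) (rule abs_triangle_ineq)
  also have "\<dots> \<le> a / npairs * (\<Sum>p\<in>(pairs :: ('n\<times>'n) set). \<bar>\<Delta>\<bar>)
    + b / real CARD('n) * (\<Sum>j\<in>(UNIV :: 'n set). if j = t then 0 else \<bar>\<Delta>\<bar>)"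
    unfolding abs_mult using a b npairs_pos N_pos T
    by (intro add_mono mult_mono order_trans[OF sum_abs] sum_mono sum_nonneg) auto
  also have "(\<Sum>j\<in>(UNIV :: 'n set). if j = t then 0 else \<bar>\<Delta>\<bar>) = (\<Sum>j\<in>(UNIV :: 'n set). \<bar>\<Delta>\<bar> - (if j = t then \<bar>\<Delta>\<bar> else 0))"
    by (rule sum.cong) auto
  also have "a / npairs * (\<Sum>p\<in>(pairs :: ('n\<times>'n) set). \<bar>\<Delta>\<bar>) + b / real CARD('n) * \<dots> = \<bar>\<Delta>\<bar> - b / real CARD('n) * \<bar>\<Delta>\<bar>"
    using weighted_average_const[of "\<bar>\<Delta>\<bar>"] by (simp add: sum_subtractf right_diff_distrib)
  finally have "b / real CARD('n) * \<bar>\<Delta>\<bar> \<le> 0" by simp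
  then show ?thesis using b N_pos by (auto simp: divide_le_0_iff mult_le_0_iff)
qed

lemma zero_on_axis: "zero_on S (axis k x) = (if k \<in> S then 0 else axis k x)"
  by (auto simp: vec_eq_iff axis_def)

text \<open>Polarization in the constant:
  \<open>(1 + x)\<^sup>2 - (- 1 + x)\<^sup>2 = 4 * x\<close>. A collision involving \<open>k\<close>
  removes the linear part and leaves the equal squares of 1 and -1.\<close>

lemma first_moment: "(\<integral>v. v $ k \<partial>M) = 0"
proof -
  have "\<Phi> (axis k 1) 1 - \<Phi> (axis k 1) (- 1) = (\<integral>v. (1 + axis k 1 \<bullet> v)\<^sup>2 - (- 1 + axis k 1 \<bullet> v)\<^sup>2 \<partial>M)"
    unfolding \<Phi>_def by (intro Bochner_Integration.integral_diff[symmetric] integrable_square)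
  also have "\<dots> = (\<integral>v. 4 * v $ k \<partial>M)"
    by (intro Bochner_Integration.integral_cong) (auto simp: inner_axis' power2_eq_square algebra_simps)
  finally have 4: "\<Phi> (axis k 1) 1 - \<Phi> (axis k 1) (- 1) = 4 * (\<integral>v. v $ k \<partial>M)" by simp
  have "\<Phi> 0 1 - \<Phi> 0 (- 1) = 0" by (simp add: \<Phi>_def)
  then have "4 * (\<integral>v. v $ k \<partial>M) = 0"
    by (intro polarized_zero[of "axis k 1" "axis k 1" k "{k}" 1 "- 1"]) (auto simp: zero_on_axis 4)
  then show ?thesis by simp
qed

lemma \<Phi>_minus: "\<Phi> (- \<alpha>) 0 = \<Phi> \<alpha> 0"
  by (simp add: \<Phi>_def)

text \<open>The sum and the difference of two unit vectors have the same squared coefficients. A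
  collision involving \<open>k\<close> or \<open>l\<close> reduces them to vectors equal up to sign,
  on which \<open>\<Phi>\<close> agrees for \<open>c = 0\<close>.\<close>

lemma mixed_moment:
  assumes kl: "k \<noteq> l"
  shows "(\<integral>v. v $ k * v $ l \<partial>M) = 0"
proof -
  let ?s = "axis k 1 + axis l 1 :: (real, 'n) vec" and ?d = "axis k 1 - axis l 1 :: (real, 'n) vec"
  have "\<Phi> ?s 0 - \<Phi> ?d 0 = (\<integral>v. (0 + ?s \<bullet> v)\<^sup>2 - (0 + ?d \<bullet> v)\<^sup>2 \<partial>M)"
    unfolding \<Phi>_def by (intro Bochner_Integration.integral_diff[symmetric] integrable_square)
  also have "\<dots> = (\<integral>v. 4 * (v $ k * v $ l) \<partial>M)"
    by (intro Bochner_Integration.integral_cong) (auto simp: inner_axis' inner_add_left inner_diff_left power2_eq_square algebra_simps)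
  finally have 4: "\<Phi> ?s 0 - \<Phi> ?d 0 = 4 * (\<integral>v. v $ k * v $ l \<partial>M)" by simp
  have s: "zero_on S ?s = zero_on S (axis k 1) + zero_on S (axis l 1)" "zero_on S ?d = zero_on S (axis k 1) - zero_on S (axis l 1)" for S
    by (auto simp: vec_eq_iff)
  have "4 * (\<integral>v. v $ k * v $ l \<partial>M) = 0"
  proof (rule polarized_zero[of ?s ?d k "{k, l}" 0 0])
    show "(?s $ i)\<^sup>2 = (?d $ i)\<^sup>2" for i using kl by (auto simp: axis_def)
    show "\<Phi> (zero_on S ?s) 0 - \<Phi> (zero_on S ?d) 0 = (if S \<inter> {k, l} = {} then 4 * (\<integral>v. v $ k * v $ l \<partial>M) else 0)" for S
      using 4 by (auto simp: s zero_on_axis \<Phi>_minus)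
  qed simp
  then show ?thesis by simp
qed

text \<open>Maximum principle for the deviation of \<open>D k\<close> from \<open>Kg\<close>. At an
  index \<open>l\<close> where it is largest, equal to \<open>m\<close>, pair collisions average
  deviations of size at most \<open>m\<close>, and the thermostat halves that of \<open>l\<close>
  with weight \<open>b / N\<close>. Hence \<open>m \<le> m - b * m / (2 * N)\<close>, which forces
  \<open>m = 0\<close>.\<close>

lemma second_moment: "(\<integral>v. (v $ k)\<^sup>2 \<partial>M) = Kg"
proof -
  define m where "m = Max (range (\<lambda>k. \<bar>D k - Kg\<bar>))"
  have m: "\<bar>D k - Kg\<bar> \<le> m" for k unfolding m_def by (rule Max_ge) auto
  have "m \<in> range (\<lambda>k. \<bar>D k - Kg\<bar>)" unfolding m_def by (rule Max_in) auto
  then obtain l where l: "m = \<bar>D l - Kg\<bar>" by blast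
  have D: "\<Phi> (axis l 1) 0 = D l" "\<Phi> 0 0 = 0" by (auto simp: \<Phi>_def D_def inner_axis')
  have ax: "axis l (1::real) $ i = (if i = l then 1 else 0)" for i by (simp add: axis_def)
  have "D l = a / npairs * (\<Sum>p\<in>pairs. if l \<in> {fst p, snd p} then (D (fst p) + D (snd p)) / 2 else D l)
    + b / real CARD('n) * (\<Sum>j\<in>UNIV. if j = l then (D l + Kg) / 2 else D l)"
    unfolding D(1)[symmetric]
    by (subst (1) \<Phi>_eq, intro arg_cong2[where f="(+)"] arg_cong2[where f="(*)"] refl sum.cong)
       (auto simp: zero_on_axis ax D dest: pairs_neq)
  then have "D l - Kg = a / npairs * (\<Sum>p\<in>pairs. if l \<in> {fst p, snd p} then (D (fst p) + D (snd p)) / 2 else D l)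
    + b / real CARD('n) * (\<Sum>j\<in>UNIV. if j = l then (D l + Kg) / 2 else D l)
    - (a / npairs * (\<Sum>p\<in>(pairs :: ('n\<times>'n) set). Kg) + b / real CARD('n) * (\<Sum>j\<in>(UNIV::'n set). Kg))"
    unfolding weighted_average_const by simp
  also have "\<dots> = a / npairs * (\<Sum>p\<in>pairs. (if l \<in> {fst p, snd p} then (D (fst p) + D (snd p)) / 2 else D l) - Kg)
    + b / real CARD('n) * (\<Sum>j\<in>UNIV. (if j = l then (D l + Kg) / 2 else D l) - Kg)"
    by (simp only: sum_subtractf right_diff_distrib)
  finally have "m \<le> \<bar>a / npairs * (\<Sum>p\<in>pairs. (if l \<in> {fst p, snd p} then (D (fst p) + D (snd p)) / 2 else D l) - Kg)\<bar>
    + \<bar>b / real CARD('n) * (\<Sum>j\<in>UNIV. (if j = l then (D l + Kg) / 2 else D l) - Kg)\<bar>"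
    unfolding l by (simp only: abs_triangle_ineq)
  also have "\<dots> \<le> a / npairs * (\<Sum>p\<in>(pairs :: ('n\<times>'n) set). m) + b / real CARD('n) * (\<Sum>j\<in>UNIV. if j = l then m / 2 else m)"
  proof -
    have "\<bar>(if l \<in> {fst p, snd p} then (D (fst p) + D (snd p)) / 2 else D l) - Kg\<bar> \<le> m" for p
      using m[of "fst p"] m[of "snd p"] m[of l] by (auto simp: abs_le_iff add_divide_distrib; linarith)
    moreover have "\<bar>(if j = l then (D l + Kg) / 2 else D l) - Kg\<bar> \<le> (if j = l then m / 2 else m)" for j
      using m[of l] by (auto simp: abs_le_iff add_divide_distrib; linarith)
    moreover have "0 \<le> m" using l by simp
    ultimately show ?thesis
      unfolding abs_mult using a b npairs_pos N_pos
      by (intro add_mono mult_mono order_trans[OF sum_abs] sum_mono sum_nonneg) auto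
  qed
  also have "(\<Sum>j\<in>UNIV. if j = l then m / 2 else m) = (\<Sum>j\<in>(UNIV :: 'n set). m - (if j = l then m / 2 else 0))"
    by (rule sum.cong) auto
  also have "a / npairs * (\<Sum>p\<in>(pairs :: ('n\<times>'n) set). m) + b / real CARD('n) * \<dots> = m - b / real CARD('n) * (m / 2)"
    using weighted_average_const[of m] by (simp add: sum_subtractf right_diff_distrib)
  finally have "b / real CARD('n) * (m / 2) \<le> 0" by simp
  then have "m \<le> 0" using b N_pos by (auto simp: divide_le_0_iff mult_le_0_iff)
  with m[of k] show ?thesis by (simp add: D_def)
qed

end

section \<open>Steady states\<close>

lemma interval_average_eq_angle:
  fixes f :: "real \<Rightarrow> real"
  assumes [measurable]: "f \<in> borel_measurable borel" and nn: "\<And>\<theta>. 0 \<le> f \<theta>"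
  shows "(1 / (2*pi)) * (LBINT \<theta>=0..2*pi. f \<theta>) = enn2real (\<integral>\<^sup>+\<theta>. ennreal (f \<theta>) \<partial>angle)"
proof -
  have "(LBINT \<theta>=0..2*pi. f \<theta>) = (LBINT \<theta>:{0..2*pi}. f \<theta>)"
    using interval_integral_Icc[of 0 "2*pi" f] by (simp add: zero_ereal_def)
  also have "\<dots> = enn2real (\<integral>\<^sup>+\<theta>. ennreal (f \<theta>) * indicator {0..2*pi} \<theta> \<partial>lborel)"
    unfolding set_lebesgue_integral_def
    by (subst integral_eq_nn_integral)
       (auto simp: nn indicator_def intro!: arg_cong[where f=enn2real] nn_integral_cong)
  finally show ?thesis
    by (subst nn_integral_angle) (simp_all add: enn2real_mult)
qed

context thermostatted_kac
begin

text \<open>The dual of each single gain fixes the constant 1. Finite mass then makes every summand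
  of the gain finite almost everywhere.\<close>

lemma gain_mass:
  fixes f :: "real^'n::{finite,linorder} \<Rightarrow> ennreal"
  assumes [measurable]: "f \<in> borel_measurable borel"
  shows "i \<noteq> j \<Longrightarrow> (\<integral>\<^sup>+v. pair_gain i j f v \<partial>lborel) = (\<integral>\<^sup>+v. f v \<partial>lborel)"
    and "(\<integral>\<^sup>+v. therm_gain g k f v \<partial>lborel) = (\<integral>\<^sup>+v. f v \<partial>lborel)"
  using pair_gain_duality[of f "\<lambda>_. 1" i j] therm_gain_duality[of f "\<lambda>_. 1" g k]
  by (simp_all add: pair_gain_dual_def therm_gain_dual_def g_nn_mass)

lemma pair_average_eq_gain:
  fixes F :: "real^'n::{finite,linorder} \<Rightarrow> real"
  assumes [measurable]: "F \<in> borel_measurable borel" and nn: "\<And>v. 0 \<le> F v"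
  shows "(1 / (2*pi)) * (LBINT \<theta>=0..2*pi. F (pair_rot i j \<theta> v)) = enn2real (pair_gain i j (\<lambda>v. ennreal (F v)) v)"
  unfolding pair_gain_def by (rule interval_average_eq_angle) (auto simp: nn)

text \<open>Finiteness of the double integral confines infinite angle averages to a null set of
  \<open>w\<close>, where replacing them by the default value 0 does not change the outer
  integral.\<close>

lemma thermR_eq_gain:
  fixes F :: "real^'n::{finite,linorder} \<Rightarrow> real"
  assumes [measurable]: "F \<in> borel_measurable borel" and nn: "\<And>v. 0 \<le> F v"
    and fin: "therm_gain g j (\<lambda>v. ennreal (F v)) v < \<infinity>"
  shows "thermR g j F v = enn2real (therm_gain g j (\<lambda>v. ennreal (F v)) v)"
proof -
  define I where "I w = (\<integral>\<^sup>+\<theta>. ennreal (g (w * cos \<theta> - v $ j * sin \<theta>)) * ennreal (F (therm_rot j w \<theta> v)) \<partial>angle)" for w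
  have [measurable]: "I \<in> borel_measurable borel" unfolding I_def therm_rot_upd by measurable
  have I: "(\<integral>\<^sup>+w. I w \<partial>lborel) = therm_gain g j (\<lambda>v. ennreal (F v)) v"
    by (simp add: I_def therm_gain_def)
  have "(1 / (2*pi)) * (LBINT \<theta>=0..2*pi. g (w * cos \<theta> - v $ j * sin \<theta>) * F (therm_rot j w \<theta> v)) = enn2real (I w)" for w
    unfolding I_def
    by (subst interval_average_eq_angle) (auto simp: nn g_nonneg ennreal_mult therm_rot_upd)
  then have "thermR g j F v = (\<integral>w. enn2real (I w) \<partial>lborel)" by (simp add: thermR_def)
  also have "\<dots> = enn2real (\<integral>\<^sup>+w. ennreal (enn2real (I w)) \<partial>lborel)"
    by (rule integral_eq_nn_integral) auto
  also have "(\<integral>\<^sup>+w. ennreal (enn2real (I w)) \<partial>lborel) = (\<integral>\<^sup>+w. I w \<partial>lborel)"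
  proof (rule nn_integral_cong_AE)
    have "AE w in lborel. I w \<noteq> \<infinity>" using fin I by (intro nn_integral_PInf_AE) auto
    then show "AE w in lborel. ennreal (enn2real (I w)) = I w"
      by eventually_elim (simp add: less_top)
  qed
  finally show ?thesis by (simp only: I)
qed

text \<open>Off a null set all gains are finite, so the real operators agree with their
  \<open>ennreal\<close> counterparts, and \<open>kacL\<close> is a nonzero multiple of gain minus
  identity.\<close>

lemma kacL_zero_iff:
  fixes F :: "real^'n::{finite,linorder} \<Rightarrow> real"
  assumes [measurable]: "F \<in> borel_measurable borel" and nn: "\<And>v. 0 \<le> F v"
    and mass: "(\<integral>\<^sup>+v. ennreal (F v) \<partial>lborel) = 1"
    and rates: "lam = r * a" "mu = r * b" "0 < r"
  shows "AE v in lborel. kacL lam mu g F v = 0 \<longleftrightarrow> P (\<lambda>v. ennreal (F v)) v = ennreal (F v)"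
proof -
  let ?f = "\<lambda>v. ennreal (F v)"
  have "AE v in lborel. \<forall>p\<in>pairs. pair_gain (fst p) (snd p) ?f v \<noteq> \<infinity>"
    by (intro AE_finite_allI nn_integral_PInf_AE) (auto simp: gain_mass mass pairs_neq)
  moreover have "AE v in lborel. \<forall>j\<in>UNIV. therm_gain g j ?f v \<noteq> \<infinity>"
    by (intro AE_finite_allI nn_integral_PInf_AE) (auto simp: gain_mass mass)
  ultimately show ?thesis
  proof eventually_elim
    case (elim v)
    define q where "q p = enn2real (pair_gain (fst p) (snd p) ?f v)" for p :: "'n \<times> 'n"
    define t where "t j = enn2real (therm_gain g j ?f v)" for j
    have q: "pair_gain (fst p) (snd p) ?f v = ennreal (q p)" if "p \<in> pairs" for p
      using elim(1) that by (simp add: q_def less_top)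
    have t: "therm_gain g j ?f v = ennreal (t j)" for j
      using elim(2) by (simp add: t_def less_top)
    have P: "P ?f v = ennreal (a / npairs * (\<Sum>p\<in>pairs. q p) + b / real CARD('n) * (\<Sum>j\<in>UNIV. t j))"
      by (subst weighted_average[symmetric]) (simp_all add: kac_gain_def npairs_def q t, simp_all add: q_def t_def)
    have P0: "0 \<le> a / npairs * (\<Sum>p\<in>pairs. q p) + b / real CARD('n) * (\<Sum>j\<in>UNIV. t j)"
      using a b npairs_pos N_pos by (intro add_nonneg_nonneg mult_nonneg_nonneg sum_nonneg) (auto simp: q_def t_def)
    have Q: "kacQ F v = 1 / npairs * (\<Sum>p\<in>pairs. q p)"
      unfolding kacQ_def npairs_def card_pairs pairs_def[symmetric] q_def
      by (simp only: pair_average_eq_gain[OF assms(1) nn])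
    have R: "thermR g j F v = t j" for j
      unfolding t_def using elim(2) by (intro thermR_eq_gain nn) (auto simp: less_top)
    have "kacL lam mu g F v = - (r * real CARD('n)) *
        ((a + b) * F v - (a / npairs * (\<Sum>p\<in>pairs. q p) + b / real CARD('n) * (\<Sum>j\<in>UNIV. t j)))"
      using N_pos npairs_pos by (simp add: kacL_def Q R rates sum_subtractf field_simps)
    then have "kacL lam mu g F v = 0 \<longleftrightarrow> F v = a / npairs * (\<Sum>p\<in>pairs. q p) + b / real CARD('n) * (\<Sum>j\<in>UNIV. t j)"
      using N_pos rates by (simp add: ab)
    then show ?case
      unfolding P using P0 nn[of v] by (auto simp: ennreal_inj simp del: ennreal_plus)
  qed
qed

end

section \<open>Moments of the product density and conclusion\<close>

lemma tensor_integral: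
  fixes u :: "'n::finite \<Rightarrow> real \<Rightarrow> real"
  assumes int: "\<And>k. integrable lborel (u k)"
  shows "integrable lborel (\<lambda>v::real^'n. \<Prod>k\<in>UNIV. u k (v $ k))"
    and "(\<integral>v. (\<Prod>k\<in>UNIV. u k ((v::real^'n) $ k)) \<partial>lborel) = (\<Prod>k\<in>UNIV. \<integral>w. u k w \<partial>lborel)"
proof -
  interpret product_sigma_finite "\<lambda>_::'n. lborel :: real measure" by standard
  have [measurable]: "u k \<in> borel_measurable borel" for k
    using borel_measurable_integrable[OF int[of k]] by simp
  show "integrable lborel (\<lambda>v::real^'n. \<Prod>k\<in>UNIV. u k (v $ k))"
    by (subst lborel_vec, subst integrable_distr_eq) (auto intro!: product_integrable_prod int)
  show "(\<integral>v. (\<Prod>k\<in>UNIV. u k ((v::real^'n) $ k)) \<partial>lborel) = (\<Prod>k\<in>UNIV. \<integral>w. u k w \<partial>lborel)"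
    by (subst lborel_vec, subst integral_distr) (auto simp: product_integral_prod int)
qed

lemma tensor_pow_moments:
  fixes g :: "real \<Rightarrow> real"
  assumes int: "integrable lborel g" "integrable lborel (\<lambda>w. w * g w)" "integrable lborel (\<lambda>w. w\<^sup>2 * g w)"
    and mom: "(\<integral>w. g w \<partial>lborel) = 1" "(\<integral>w. w * g w \<partial>lborel) = 0"
  shows "has_bochner_integral lborel (tensor_pow g :: real^'n::finite \<Rightarrow> real) 1"
    and "has_bochner_integral lborel (\<lambda>v::real^'n. v $ i * tensor_pow g v) 0"
    and "has_bochner_integral lborel (\<lambda>v::real^'n. v $ i * v $ j * tensor_pow g v)
          (if i = j then \<integral>w. w\<^sup>2 * g w \<partial>lborel else 0)"
proof -
  have *: "has_bochner_integral lborel (\<lambda>v::real^'n. (\<Prod>k\<in>UNIV. c k (v $ k)) * tensor_pow g v) (\<Prod>k\<in>UNIV. \<integral>w. c k w * g w \<partial>lborel)"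
    if "\<And>k. integrable lborel (\<lambda>w. c k w * g w)" for c :: "'n \<Rightarrow> real \<Rightarrow> real"
    using tensor_integral[of "\<lambda>k w. c k w * g w", OF that]
    by (simp add: has_bochner_integral_iff tensor_pow_def prod.distrib)
  show "has_bochner_integral lborel (tensor_pow g :: real^'n \<Rightarrow> real) 1"
    using *[of "\<lambda>_ _. 1"] int mom by simp
  have one: "(\<Prod>k\<in>UNIV. if k = i then f k else 1) = f i" for f :: "'n \<Rightarrow> real" and i
    by (simp add: prod.delta)
  show "has_bochner_integral lborel (\<lambda>v::real^'n. v $ i * tensor_pow g v) 0"
  proof -
    let ?c = "\<lambda>k w. if k = i then w else (1::real)"
    have c: "integrable lborel (\<lambda>w. ?c k w * g w)" for k using int by (cases "k = i") auto
    have m: "(\<Prod>k\<in>UNIV. \<integral>w. ?c k w * g w \<partial>lborel) = 0"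
      by (intro prod_zero bexI[of _ i]) (use mom in auto)
    show ?thesis using *[of ?c, OF c] unfolding m one .
  qed
  show "has_bochner_integral lborel (\<lambda>v::real^'n. v $ i * v $ j * tensor_pow g v)
          (if i = j then \<integral>w. w\<^sup>2 * g w \<partial>lborel else 0)"
  proof -
    \<comment> \<open>The two factors multiply at a common index, so the same formula produces the
      square of the velocity when \<open>i = j\<close>.\<close>
    let ?c = "\<lambda>k w. (if k = i then w else 1) * (if k = j then w else (1::real))"
    have c: "integrable lborel (\<lambda>w. ?c k w * g w)" for k
      using int by (cases "k = i"; cases "k = j") (auto simp: power2_eq_square)
    have m: "(\<Prod>k\<in>UNIV. \<integral>w. ?c k w * g w \<partial>lborel) = (if i = j then \<integral>w. w\<^sup>2 * g w \<partial>lborel else 0)"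
    proof (cases "i = j")
      case True
      have "(\<integral>w. ?c k w * g w \<partial>lborel) = (if k = j then \<integral>w. w\<^sup>2 * g w \<partial>lborel else 1)" for k
        using True mom by (simp add: power2_eq_square)
      then show ?thesis using True one[of j "\<lambda>_. \<integral>w. w\<^sup>2 * g w \<partial>lborel"] by simp
    next
      case False
      then have "(\<Prod>k\<in>UNIV. \<integral>w. ?c k w * g w \<partial>lborel) = 0"
        by (intro prod_zero bexI[of _ i]) (use mom in auto)
      then show ?thesis using False by simp
    qed
    show ?thesis using *[of ?c, OF c] unfolding m prod.distrib one .
  qed
qed

theorem theorem1:
  fixes lam mu :: real and g :: "real \<Rightarrow> real"
  assumes N: "CARD('n::{finite,linorder}) \<ge> 2"
    and lam: "lam > 0" and mu: "mu > 0"
    and g_meas: "g \<in> borel_measurable lborel"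
    and g_nonneg: "\<And>w. 0 \<le> g w"
    and g_int: "integrable lborel g" and g_mass: "(\<integral>w. g w \<partial>lborel) = 1"
    and g_L2: "integrable lborel (\<lambda>w. (g w)\<^sup>2)"
    and g_mean_int: "integrable lborel (\<lambda>w. w * g w)"
    and g_mean: "(\<integral>w. w * g w \<partial>lborel) = 0"
    and g_second: "integrable lborel (\<lambda>w. w\<^sup>2 * g w)"
  shows "\<exists>F :: real^'n::{finite,linorder} \<Rightarrow> real.
           steady_state lam mu g F \<and>
           (\<forall>G :: real^'n::{finite,linorder} \<Rightarrow> real. steady_state lam mu g G \<longrightarrow> (AE v in lborel. G v = F v)) \<and>
           same_moments_le2 F (tensor_pow g)"
proof -
  interpret thermostatted_kac "lam / (lam + mu)" "mu / (lam + mu)" g "TYPE('n)"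
    using assms by unfold_locales (auto simp: add_divide_distrib[symmetric])
  have rates: "lam = (lam + mu) * (lam / (lam + mu))" "mu = (lam + mu) * (mu / (lam + mu))" "0 < lam + mu"
    using lam mu by auto
  obtain f :: "(real, 'n) vec \<Rightarrow> ennreal" where f [measurable]: "f \<in> borel_measurable borel"
    and f1: "(\<integral>\<^sup>+v. f v \<partial>lborel) = 1" and fP: "AE v in lborel. P f v = f v"
    and fE: "(\<integral>\<^sup>+v. ennreal (energy v) * f v \<partial>lborel) < \<infinity>"
    and unique: "\<And>f'. \<lbrakk>f' \<in> borel_measurable borel; (\<integral>\<^sup>+v. f' v \<partial>lborel) = 1; AE v in lborel. P f' v = f' v\<rbrakk> \<Longrightarrow> AE v in lborel. f' v = f v"
    using invariant_density by blast
  \<comment> \<open>A steady state must be real-valued. As \<open>f\<close> is finite almost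
    everywhere, this changes it only on a null set, and \<open>P_cong_AE\<close> shows that the gain
    is not affected.\<close>
  define F where "F v = enn2real (f v)" for v
  have [measurable]: "F \<in> borel_measurable borel" unfolding F_def by measurable
  have F0: "0 \<le> F v" for v by (simp add: F_def)
  have "AE v in lborel. f v \<noteq> \<infinity>" using f1 by (intro nn_integral_PInf_AE) auto
  then have Ff: "AE v in lborel. ennreal (F v) = f v"
    by eventually_elim (simp add: F_def less_top)
  have F1: "(\<integral>\<^sup>+v. ennreal (F v) \<partial>lborel) = 1" using nn_integral_cong_AE[OF Ff] f1 by simp
  have "AE v in lborel. P (\<lambda>v. ennreal (F v)) v = P f v"
    by (rule P_cong_AE) (use Ff f1 in auto)
  then have FP: "AE v in lborel. P (\<lambda>v. ennreal (F v)) v = ennreal (F v)"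
    using fP Ff by eventually_elim simp
  have FE: "(\<integral>\<^sup>+v. ennreal (energy v) * ennreal (F v) \<partial>lborel) < \<infinity>"
  proof -
    have "(\<integral>\<^sup>+v. ennreal (energy v) * ennreal (F v) \<partial>lborel) = (\<integral>\<^sup>+v. ennreal (energy v) * f v \<partial>lborel)"
      by (intro nn_integral_cong_AE, use Ff in eventually_elim) simp
    then show ?thesis using fE by simp
  qed
  have density: "integrable lborel H \<and> (\<integral>v. H v \<partial>lborel) = 1"
    if "H \<in> borel_measurable borel" "\<And>v. 0 \<le> H v" "(\<integral>\<^sup>+v. ennreal (H v) \<partial>lborel) = 1" for H :: "(real, 'n) vec \<Rightarrow> real"
    using that integral_eq_nn_integral[of H lborel] by (auto intro!: integrableI_nonneg)
  have steady: "steady_state lam mu g F"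
    unfolding steady_state_def prob_density_def
    using kacL_zero_iff[OF _ F0 F1 rates] FP density[of F] F0 F1 by auto
  moreover have "AE v in lborel. G v = F v" if "steady_state lam mu g G" for G :: "(real, 'n) vec \<Rightarrow> real"
  proof -
    from that have G: "G \<in> borel_measurable borel" "\<And>v. 0 \<le> G v" "integrable lborel G" "(\<integral>v. G v \<partial>lborel) = 1"
      and GL: "AE v in lborel. kacL lam mu g G v = 0"
      by (auto simp: steady_state_def prob_density_def)
    have G1: "(\<integral>\<^sup>+v. ennreal (G v) \<partial>lborel) = 1" using G by (simp add: nn_integral_eq_integral)
    have "AE v in lborel. P (\<lambda>v. ennreal (G v)) v = ennreal (G v)"
      using kacL_zero_iff[OF G(1,2) G1 rates] GL by eventually_elim simp
    then have "AE v in lborel. ennreal (G v) = f v"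
      using G G1 by (intro unique) auto
    with Ff show ?thesis
      by eventually_elim (metis F_def G(2) enn2real_ennreal)
  qed
  moreover have "same_moments_le2 F (tensor_pow g)"
  proof -
    \<comment> \<open>Duality turns the invariance of F under \<open>P\<close> into the weak
      stationarity of this measure.\<close>
    define M where "M = density lborel (\<lambda>v. ennreal (F v))"
    have nn_M: "(\<integral>\<^sup>+v. h v \<partial>M) = (\<integral>\<^sup>+v. h v * ennreal (F v) \<partial>lborel)" if "h \<in> borel_measurable borel" for h
      using that by (simp add: M_def nn_integral_density mult.commute)
    have M1: "emeasure M UNIV = 1" using nn_M[of "\<lambda>_. 1"] F1 by (simp add: M_def)
    interpret M: stationary_measure "lam / (lam + mu)" "mu / (lam + mu)" g "TYPE('n)" M
    proof unfold_locales
      show "\<exists>A. countable A \<and> A \<subseteq> sets M \<and> \<Union> A = space M \<and> (\<forall>a\<in>A. emeasure M a \<noteq> \<infinity>)"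
        using M1 by (intro exI[of _ "{UNIV}"]) (auto simp: M_def)
      show "emeasure M (space M) \<noteq> top" using M1 by (simp add: M_def)
      show "measure M UNIV = 1" by (simp add: measure_def M1)
      show "sets M = sets borel" by (simp add: M_def)
      fix h :: "(real, 'n) vec \<Rightarrow> ennreal" assume h: "h \<in> borel_measurable borel"
      have "(\<integral>\<^sup>+v. h v * ennreal (F v) \<partial>lborel) = (\<integral>\<^sup>+v. h v * P (\<lambda>v. ennreal (F v)) v \<partial>lborel)"
        by (intro nn_integral_cong_AE, use FP in eventually_elim) simp
      then show "(\<integral>\<^sup>+v. h v \<partial>M) = (\<integral>\<^sup>+v. Ps h v \<partial>M)"
        using h Ps_measurable[of h] by (simp add: nn_M duality)
    next
      show "integrable M energy"
        using FE by (intro integrableI_nonneg) (auto simp: nn_M, simp_all add: M_def)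
    qed
    have transfer: "has_bochner_integral lborel (\<lambda>v. h v * F v) (\<integral>v. h v \<partial>M)"
      if "integrable M h" "h \<in> borel_measurable borel" for h :: "(real, 'n) vec \<Rightarrow> real"
      using that F0 by (simp add: M_def has_bochner_integral_iff integrable_density integral_density mult.commute)
    have "has_bochner_integral lborel F 1" using density[of F] F0 F1 by (simp add: has_bochner_integral_iff)
    moreover have "has_bochner_integral lborel (\<lambda>v. v $ i * F v) 0" for i
      using transfer[OF M.integrable_component[of i]] M.first_moment by simp
    moreover have "has_bochner_integral lborel (\<lambda>v. v $ i * v $ j * F v) (if i = j then \<integral>w. w\<^sup>2 * g w \<partial>lborel else 0)" for i j
      using transfer[OF M.integrable_component_prod[of i j]] M.second_moment[of i] M.mixed_moment[of i j]
      by (auto simp: Kg_def power2_eq_square split: if_splits)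
    ultimately show ?thesis
      using tensor_pow_moments[OF g_int g_mean_int g_second g_mass g_mean, where 'n='n]
      unfolding same_moments_le2_def has_bochner_integral_iff by simp
  qed
  ultimately show ?thesis by blast
qed

end
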